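(* Let $a<b$, $\alpha\in(0,1)$, $\beta>0$, $y_a,y_b,\gamma\in\mathbb{R}$, and let $L:(x,y,v,w,z)\mapsto L(x,y,v,w,z)$, $G:(x,y,v,w,z)\mapsto G(x,y,v,w,z)$ and $l:(x,y,v,w)\mapsto l(x,y,v,w)$ be real-valued functions of class $C^1$. For $y\in\mathcal{F}([a,b];\mathbb{R})$ put $$z(x)=\int_a^x l\bigl(t,y(t),{^C_aD_t^\alpha}y(t),{_aI_t^\beta}y(t)\bigr)\,dt,$$ $\{y\}(x)=(x,y(x),{^C_aD_x^\alpha}y(x),{_aI_x^\beta}y(x))$, $[y](x)=(x,y(x),{^C_aD_x^\alpha}y(x),{_aI_x^\beta}y(x),z(x))$, $J(y)=\int_a^b L[y](x)\,dx$ and $I(y)=\int_a^b G[y](x)\,dx$. Let $y\in\mathcal{F}([a,b];\mathbb{R})$ be a minimizer of $J$ under the boundary conditions $y(a)=y_a$, $y(b)=y_b$ and the isoperimetric constraint $I(y)=\gamma$. Suppose that $y$ is not an extremal for $I$. Then there exists a constant $\lambda$ such that, with $F=L-\lambda G$, $y$ satisfies for all $x\in[a,b]$ the fractional equation $$\frac{\partial F}{\partial y}[y](x)+{_xD^\alpha_b}\left(\frac{\partial F}{\partial v}[y](x)\right)+{_xI^\beta_b}\left(\frac{\partial F}{\partial w}[y](x)\right)+\int_x^b\frac{\partial F}{\partial z}[y](t)\,dt\cdot\frac{\partial l}{\partial y}\{y\}(x)$$ $$+{_xD^\alpha_b}\left(\int_x^b\frac{\partial F}{\partial z}[y](t)\,dt\cdot\frac{\partial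 l}{\partial v}\{y\}(x)\right)+{_xI^\beta_b}\left(\int_x^b\frac{\partial F}{\partial z}[y](t)\,dt\cdot\frac{\partial l}{\partial w}\{y\}(x)\right)=0.$$
   Context: For $\gamma>0$, the left and right Riemann--Liouville fractional integrals of order $\gamma$ are ${_aI_x^\gamma}f(x)=\frac{1}{\Gamma(\gamma)}\int_a^x(x-t)^{\gamma-1}f(t)\,dt$ and ${_xI_b^\gamma}f(x)=\frac{1}{\Gamma(\gamma)}\int_x^b(t-x)^{\gamma-1}f(t)\,dt$ (this $\gamma$ is unrelated to the constraint constant). For $\alpha\in(0,1)$, the right Riemann--Liouville fractional derivative is ${_xD_b^\alpha}f(x)=\frac{-1}{\Gamma(1-\alpha)}\frac{d}{dx}\int_x^b(t-x)^{-\alpha}f(t)\,dt$, and the left Caputo fractional derivative of an absolutely continuous $f$ is ${^C_aD_x^\alpha}f(x)=\frac{1}{\Gamma(1-\alpha)}\int_a^x(x-t)^{-\alpha}f'(t)\,dt$. $\mathcal{F}([a,b];\mathbb{R})$ denotes the class of absolutely continuous functions $y:[a,b]\to\mathbb{R}$ such that ${^C_aD_x^\alpha}y(x)$ and ${_aI_x^\beta}y(x)$ exist and are continuous on $[a,b]$. An extremal for $I$ is a solution $y$, on $[a,b]$, of the fractional Euler--Lagrange equation of $I$: $$\frac{\partial G}{\partial y}[y](x)+{_xD^\alpha_b}\left(\frac{\partial G}{\partial v}[y](x)\right)+{_xI_b^\beta}\left(\frac{\partial G}{\partial w}[y](x)\right)+\int_x^b\frac{\partial G}{\partial z}[y](t)\,dt\cdot\frac{\partial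 l}{\partial y}\{y\}(x)+{_xD^\alpha_b}\left(\int_x^b\frac{\partial G}{\partial z}[y](t)\,dt\cdot\frac{\partial l}{\partial v}\{y\}(x)\right)+{_xI^\beta_b}\left(\int_x^b\frac{\partial G}{\partial z}[y](t)\,dt\cdot\frac{\partial l}{\partial w}\{y\}(x)\right)=0.$$ Partial derivatives of $L,G,F$ are with respect to their named variables and are evaluated at $[y](\cdot)$; those of $l$ are evaluated at $\{y\}(\cdot)$. An expression such as ${_xD_b^\alpha}(\phi(x))$ means the operator applied to the function $\phi$, evaluated at $x$.
   Formalization: Added assumption: for K = L and K = G, the right Riemann–Liouville derivative of (∫_x^b ∂K/∂z[y](t)dt)·∂l/∂v{y}(x) exists at every x in [a,b]; without it the separate terms of the equation may fail to exist and the claim is false. *)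

theory Defs
  imports "HOL-Analysis.Analysis"
begin

section \<open>Regularity notions\<close>

text \<open>Continuous Frechet differentiability relative to a set. It is used for sets of the form
  \<open>{a..b} \<times> UNIV\<close>, where derivatives within the set are unique; every function that is
  \<open>C\<^sup>1\<close> on the whole space satisfies it.\<close>

definition C1_on :: "'a::real_normed_vector set \<Rightarrow> ('a \<Rightarrow> real) \<Rightarrow> bool" where
  "C1_on S f \<longleftrightarrow>
     (\<exists>f' :: 'a \<Rightarrow> ('a \<Rightarrow>\<^sub>L real).
        (\<forall>p\<in>S. (f has_derivative blinfun_apply (f' p)) (at p within S)) \<and> continuous_on S f')"

text \<open>A pair \<open>(u, v)\<close> in the family \<open>P\<close> stands for the open interval from \<open>u\<close> to \<open>v\<close>.\<close>

definition abs_continuous_on_interval :: "real \<Rightarrow> real \<Rightarrow> (real \<Rightarrow> real) \<Rightarrow> bool" where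
  "abs_continuous_on_interval a b f \<longleftrightarrow>
     (\<forall>\<epsilon>>0. \<exists>\<delta>>0. \<forall>P :: (real \<times> real) set.
        finite P \<longrightarrow> (\<forall>(u, v)\<in>P. a \<le> u \<and> u \<le> v \<and> v \<le> b) \<longrightarrow>
        disjoint_family_on (\<lambda>(u, v). {u<..<v}) P \<longrightarrow>
        (\<Sum>(u, v)\<in>P. v - u) < \<delta> \<longrightarrow> (\<Sum>(u, v)\<in>P. \<bar>f v - f u\<bar>) < \<epsilon>)"

section \<open>Fractional operators\<close>

text \<open>Existence of the Lebesgue integrals is recorded by \<^const>\<open>absolutely_integrable_on\<close>; in that
  case \<^const>\<open>integral\<close> is the Lebesgue integral. The convention \<open>0 powr r = 0\<close> affects the kernels
  below at a single point only.\<close>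

definition rl_int_left :: "real \<Rightarrow> real \<Rightarrow> (real \<Rightarrow> real) \<Rightarrow> real \<Rightarrow> real" where
  "rl_int_left a \<beta> f x = 1 / Gamma \<beta> * integral {a..x} (\<lambda>t. (x - t) powr (\<beta> - 1) * f t)"

definition rl_int_left_exists :: "real \<Rightarrow> real \<Rightarrow> (real \<Rightarrow> real) \<Rightarrow> real \<Rightarrow> bool" where
  "rl_int_left_exists a \<beta> f x \<longleftrightarrow>
     (\<lambda>t. (x - t) powr (\<beta> - 1) * f t) absolutely_integrable_on {a..x}"

definition rl_int_right :: "real \<Rightarrow> real \<Rightarrow> (real \<Rightarrow> real) \<Rightarrow> real \<Rightarrow> real" where
  "rl_int_right b \<beta> f x = 1 / Gamma \<beta> * integral {x..b} (\<lambda>t. (t - x) powr (\<beta> - 1) * f t)"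

text \<open>The derivative in the right Riemann--Liouville derivative is taken within \<open>{a..b}\<close>, hence
  one-sided at the end points.\<close>

definition rl_deriv_right :: "real \<Rightarrow> real \<Rightarrow> real \<Rightarrow> (real \<Rightarrow> real) \<Rightarrow> real \<Rightarrow> real" where
  "rl_deriv_right a b \<alpha> f x =
     - 1 / Gamma (1 - \<alpha>) *
       vector_derivative (\<lambda>s. integral {s..b} (\<lambda>t. (t - s) powr (- \<alpha>) * f t)) (at x within {a..b})"

definition rl_deriv_right_exists :: "real \<Rightarrow> real \<Rightarrow> real \<Rightarrow> (real \<Rightarrow> real) \<Rightarrow> real \<Rightarrow> bool" where
  "rl_deriv_right_exists a b \<alpha> f x \<longleftrightarrow>
     (\<lambda>s. integral {s..b} (\<lambda>t. (t - s) powr (- \<alpha>) * f t)) differentiable (at x within {a..b})"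

text \<open>The Caputo derivative of an absolutely continuous \<open>f\<close> involves \<open>f'\<close>, which is defined almost
  everywhere; \<^const>\<open>deriv\<close> takes an irrelevant value on the exceptional null set.\<close>

definition caputo_left :: "real \<Rightarrow> real \<Rightarrow> (real \<Rightarrow> real) \<Rightarrow> real \<Rightarrow> real" where
  "caputo_left a \<alpha> f x = 1 / Gamma (1 - \<alpha>) * integral {a..x} (\<lambda>t. (x - t) powr (- \<alpha>) * deriv f t)"

definition caputo_left_exists :: "real \<Rightarrow> real \<Rightarrow> (real \<Rightarrow> real) \<Rightarrow> real \<Rightarrow> bool" where
  "caputo_left_exists a \<alpha> f x \<longleftrightarrow>
     (AE t in lebesgue. t \<in> {a..x} \<longrightarrow> f differentiable (at t)) \<and>
     (\<lambda>t. (x - t) powr (- \<alpha>) * deriv f t) absolutely_integrable_on {a..x}"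

definition admissible_class :: "real \<Rightarrow> real \<Rightarrow> real \<Rightarrow> real \<Rightarrow> (real \<Rightarrow> real) set" where
  "admissible_class a b \<alpha> \<beta> =
     {y. abs_continuous_on_interval a b y \<and>
         (\<forall>x\<in>{a..b}. caputo_left_exists a \<alpha> y x) \<and> continuous_on {a..b} (caputo_left a \<alpha> y) \<and>
         (\<forall>x\<in>{a..b}. rl_int_left_exists a \<beta> y x) \<and> continuous_on {a..b} (rl_int_left a \<beta> y)}"

section \<open>Functionals and the fractional Euler--Lagrange equation\<close>

type_synonym lagrangian = "real \<times> real \<times> real \<times> real \<times> real \<Rightarrow> real"
type_synonym integrand = "real \<times> real \<times> real \<times> real \<Rightarrow> real"

definition d_y :: "lagrangian \<Rightarrow> lagrangian" where
  "d_y K = (\<lambda>(x, y, v, w, z). deriv (\<lambda>s. K (x, s, v, w, z)) y)"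

definition d_v :: "lagrangian \<Rightarrow> lagrangian" where
  "d_v K = (\<lambda>(x, y, v, w, z). deriv (\<lambda>s. K (x, y, s, w, z)) v)"

definition d_w :: "lagrangian \<Rightarrow> lagrangian" where
  "d_w K = (\<lambda>(x, y, v, w, z). deriv (\<lambda>s. K (x, y, v, s, z)) w)"

definition d_z :: "lagrangian \<Rightarrow> lagrangian" where
  "d_z K = (\<lambda>(x, y, v, w, z). deriv (\<lambda>s. K (x, y, v, w, s)) z)"

definition l_y :: "integrand \<Rightarrow> integrand" where
  "l_y l = (\<lambda>(x, y, v, w). deriv (\<lambda>s. l (x, s, v, w)) y)"

definition l_v :: "integrand \<Rightarrow> integrand" where
  "l_v l = (\<lambda>(x, y, v, w). deriv (\<lambda>s. l (x, y, s, w)) v)"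

definition l_w :: "integrand \<Rightarrow> integrand" where
  "l_w l = (\<lambda>(x, y, v, w). deriv (\<lambda>s. l (x, y, v, s)) w)"

text \<open>\<open>jet\<close> and \<open>jet_z\<close> are the curly and square bracket evaluations along \<open>y\<close>.\<close>

definition jet :: "real \<Rightarrow> real \<Rightarrow> real \<Rightarrow> (real \<Rightarrow> real) \<Rightarrow> real \<Rightarrow> real \<times> real \<times> real \<times> real" where
  "jet a \<alpha> \<beta> y x = (x, y x, caputo_left a \<alpha> y x, rl_int_left a \<beta> y x)"

definition indef :: "real \<Rightarrow> real \<Rightarrow> real \<Rightarrow> integrand \<Rightarrow> (real \<Rightarrow> real) \<Rightarrow> real \<Rightarrow> real" where
  "indef a \<alpha> \<beta> l y x = integral {a..x} (\<lambda>t. l (jet a \<alpha> \<beta> y t))"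

definition jet_z ::
  "real \<Rightarrow> real \<Rightarrow> real \<Rightarrow> integrand \<Rightarrow> (real \<Rightarrow> real) \<Rightarrow> real \<Rightarrow> real \<times> real \<times> real \<times> real \<times> real" where
  "jet_z a \<alpha> \<beta> l y x =
     (x, y x, caputo_left a \<alpha> y x, rl_int_left a \<beta> y x, indef a \<alpha> \<beta> l y x)"

definition functional ::
  "real \<Rightarrow> real \<Rightarrow> real \<Rightarrow> real \<Rightarrow> integrand \<Rightarrow> lagrangian \<Rightarrow> (real \<Rightarrow> real) \<Rightarrow> real" where
  "functional a b \<alpha> \<beta> l K y = integral {a..b} (\<lambda>x. K (jet_z a \<alpha> \<beta> l y x))"

definition tail_dz ::
  "real \<Rightarrow> real \<Rightarrow> real \<Rightarrow> real \<Rightarrow> integrand \<Rightarrow> lagrangian \<Rightarrow> (real \<Rightarrow> real) \<Rightarrow> real \<Rightarrow> real" where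
  "tail_dz a b \<alpha> \<beta> l K y x = integral {x..b} (\<lambda>t. d_z K (jet_z a \<alpha> \<beta> l y t))"

text \<open>Left-hand side of the Euler--Lagrange equation. It is meaningful only where the two right
  Riemann--Liouville derivatives exist; being a solution includes their existence. All other terms
  exist for admissible \<open>y\<close>.\<close>

definition EL_lhs ::
  "real \<Rightarrow> real \<Rightarrow> real \<Rightarrow> real \<Rightarrow> integrand \<Rightarrow> lagrangian \<Rightarrow> (real \<Rightarrow> real) \<Rightarrow> real \<Rightarrow> real" where
  "EL_lhs a b \<alpha> \<beta> l K y x =
     d_y K (jet_z a \<alpha> \<beta> l y x)
     + rl_deriv_right a b \<alpha> (\<lambda>t. d_v K (jet_z a \<alpha> \<beta> l y t)) x
     + rl_int_right b \<beta> (\<lambda>t. d_w K (jet_z a \<alpha> \<beta> l y t)) x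
     + tail_dz a b \<alpha> \<beta> l K y x * l_y l (jet a \<alpha> \<beta> y x)
     + rl_deriv_right a b \<alpha> (\<lambda>t. tail_dz a b \<alpha> \<beta> l K y t * l_v l (jet a \<alpha> \<beta> y t)) x
     + rl_int_right b \<beta> (\<lambda>t. tail_dz a b \<alpha> \<beta> l K y t * l_w l (jet a \<alpha> \<beta> y t)) x"

definition EL_solution ::
  "real \<Rightarrow> real \<Rightarrow> real \<Rightarrow> real \<Rightarrow> integrand \<Rightarrow> lagrangian \<Rightarrow> (real \<Rightarrow> real) \<Rightarrow> bool" where
  "EL_solution a b \<alpha> \<beta> l K y \<longleftrightarrow>
     (\<forall>x\<in>{a..b}.
        rl_deriv_right_exists a b \<alpha> (\<lambda>t. d_v K (jet_z a \<alpha> \<beta> l y t)) x \<and>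
        rl_deriv_right_exists a b \<alpha> (\<lambda>t. tail_dz a b \<alpha> \<beta> l K y t * l_v l (jet a \<alpha> \<beta> y t)) x \<and>
        EL_lhs a b \<alpha> \<beta> l K y x = 0)"

text \<open>An Euler--Lagrange equation splits the derivative of
  \<open>d_v K + tail_dz K \<cdot> l_v l\<close> into two summands. Stationarity of \<open>y\<close> forces the derivative of the
  sum to exist, but not those of the summands, as both \<open>d_v K\<close> and \<open>l_v l\<close> are merely
  continuous along \<open>y\<close>. The following predicate says that the splitting makes sense. It holds
  trivially if \<open>K\<close> does not depend on \<open>z\<close> or \<open>l\<close> does not depend on \<open>v\<close>; at \<open>x = b\<close> it is
  automatic, since \<open>tail_dz\<close> vanishes there to first order.\<close>

definition EL_splits ::
  "real \<Rightarrow> real \<Rightarrow> real \<Rightarrow> real \<Rightarrow> integrand \<Rightarrow> lagrangian \<Rightarrow> (real \<Rightarrow> real) \<Rightarrow> bool" where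
  "EL_splits a b \<alpha> \<beta> l K y \<longleftrightarrow>
     (\<forall>x\<in>{a..b}.
        rl_deriv_right_exists a b \<alpha> (\<lambda>t. tail_dz a b \<alpha> \<beta> l K y t * l_v l (jet a \<alpha> \<beta> y t)) x)"

end

theory Submission
  imports Defs
begin

text \<open>If \<open>h\<close> is \<open>C\<^sup>1\<close> and vanishes at \<open>a\<close> and \<open>b\<close>, then Fubini's theorem for the singular kernels and
  integration by parts bring the first variation of \<open>functional K\<close> in direction \<open>h\<close> into the form
  \<open>\<integral> h' \<cdot> M\<^sub>K\<close> with a continuous function \<open>M\<^sub>K\<close> (\<open>momentum\<close> below) that vanishes at \<open>b\<close>. If \<open>M\<^sub>K\<close> is
  constant, then it is zero, and differentiating \<open>M\<^sub>K = 0\<close> gives the Euler--Lagrange equation.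

  As \<open>y\<close> is not an extremal of \<open>G\<close>, the mean-free part \<open>g\<close> of \<open>M\<^sub>G\<close> is not zero, so the variation
  with derivative \<open>g\<close> changes \<open>functional G\<close> to first order. The multiplier is chosen such that the same
  variation leaves \<open>functional F\<close>, \<open>F = L - \<lambda>G\<close>, stationary. Then take the mean-free part \<open>m\<close> of \<open>M\<^sub>F\<close>
  as a second direction: moving along it while restoring the constraint with the first direction,
  which costs nothing to first order, shows that \<open>functional F\<close> is stationary in the second
  direction as well, that is \<open>\<integral> m\<^sup>2 = 0\<close>, so \<open>M\<^sub>F\<close> is constant.\<close>

subsection \<open>Integrals with power kernels\<close>

lemma has_integral_powr_left:
  fixes a x \<kappa> :: real
  assumes "\<kappa> > -1" "a \<le> x"
  shows "((\<lambda>t. (x - t) powr \<kappa>) has_integral (x - a) powr (\<kappa> + 1) / (\<kappa> + 1)) {a..x}"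
proof -
  have "((\<lambda>t. t powr \<kappa>) has_integral (x - a) powr (\<kappa> + 1) / (\<kappa> + 1)) (cbox 0 (x - a))"
    using has_integral_powr_from_0[of \<kappa> "x - a"] assms by simp
  from has_integral_affinity[OF this, of "-1" x]
  have "((\<lambda>t. (x - t) powr \<kappa>) has_integral (x - a) powr (\<kappa> + 1) / (\<kappa> + 1))
          ((\<lambda>t. x - t) ` {0..x - a})"
    by simp
  also have "(\<lambda>t. x - t) ` {0..x - a} = {a..x}"
    using assms by (auto simp: image_iff intro!: bexI[of _ "x - t" for t])
  finally show ?thesis .
qed

text \<open>The kernel is nonnegative with a finite integral, hence absolutely integrable. A factor
  that is continuous on a compact interval is bounded and measurable and preserves this.\<close>

lemma absolutely_integrable_powr_left:
  fixes a x \<kappa> :: real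
  assumes "\<kappa> > -1" "continuous_on {a..x} f"
  shows "(\<lambda>t. (x - t) powr \<kappa> * f t) absolutely_integrable_on {a..x}"
proof (cases "a \<le> x")
  case True
  have "(\<lambda>t. (x - t) powr \<kappa>) absolutely_integrable_on {a..x}"
    using has_integral_powr_left[OF assms(1) True]
    by (intro nonnegative_absolutely_integrable_1) (auto simp: integrable_on_def)
  then have "(\<lambda>t. f t * (x - t) powr \<kappa>) absolutely_integrable_on {a..x}"
    using assms(2)
    by (intro absolutely_integrable_bounded_measurable_product_real)
       (auto intro: continuous_imp_measurable_on_sets_lebesgue
          compact_imp_bounded compact_continuous_image)
  then show ?thesis by (simp add: mult.commute)
qed auto

text \<open>The reflection of t to -t turns the right-sided kernel into the left-sided one.\<close>

lemma absolutely_integrable_powr_right: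
  fixes b x \<kappa> :: real
  assumes "\<kappa> > -1" "continuous_on {x..b} f"
  shows "(\<lambda>t. (t - x) powr \<kappa> * f t) absolutely_integrable_on {x..b}"
proof -
  have c: "continuous_on {-b..-x} (\<lambda>t. f (-t))"
    by (rule continuous_on_compose2[OF assms(2)]) (auto intro!: continuous_intros)
  have "(\<lambda>t. (- x - t) powr \<kappa> * f (- t)) absolutely_integrable_on {-b..-x}"
    by (rule absolutely_integrable_powr_left[OF assms(1) c])
  moreover have "uminus ` {x..b} = {-b..-x}" "uminus ` {-b..-x} = {x..b}" by auto
  ultimately show ?thesis
    using has_absolute_integral_reflect_real
      [of "{x..b}" "{-b..-x}" "\<lambda>t. (- x - t) powr \<kappa> * f (- t)"
        "integral {-b..-x} (\<lambda>t. (- x - t) powr \<kappa> * f (- t))"]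
    by (simp add: algebra_simps)
qed

text \<open>Serves to move a variable upper limit x into the integrand. The degenerate case a = x is
  included so that x can range over a closed interval, and Banach space values allow integrals of
  families of linear maps.\<close>

lemma integral_unit_interval:
  fixes F :: "real \<Rightarrow> 'a::banach"
  assumes "F integrable_on {a..x}" "a \<le> x"
  shows "integral {a..x} F = (x - a) *\<^sub>R integral {0..1} (\<lambda>s. F (a + s * (x - a)))"
proof (cases "a = x")
  case False
  then have ax: "a < x" using assms by simp
  have "(F has_integral integral {a..x} F) (cbox a x)" using assms by auto
  from has_integral_affinity'[OF this, of "x - a" a]
  have "((\<lambda>s. F (a + s * (x - a))) has_integral integral {a..x} F /\<^sub>R (x - a)) {0..1}"
    using ax by (simp add: mult.commute add.commute)
  then have "integral {0..1} (\<lambda>s. F (a + s * (x - a))) = integral {a..x} F /\<^sub>R (x - a)" by auto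
  then show ?thesis using ax by simp
qed auto

text \<open>After rescaling to \<open>{0..1}\<close> the singularity no longer moves with \<open>x\<close>, and dominated
  convergence applies.\<close>

lemma continuous_on_integral_powr_left:
  fixes a b \<kappa> :: real
  assumes \<kappa>: "\<kappa> > -1" and f: "continuous_on {a..b} f"
  shows "continuous_on {a..b} (\<lambda>x. integral {a..x} (\<lambda>t. (x - t) powr \<kappa> * f t))"
proof -
  \<comment> \<open>With t = a + s * (x - a) one has x - t = (x - a) * (1 - s). So a power of x - a
    leaves the integral, \<open>g\<close> is what remains, and its singularity sits at s = 1 for
    every x.\<close>
  define g where "g x s = (1 - s) powr \<kappa> * f (a + s * (x - a))" for x s
  have mem: "a + s * (x - a) \<in> {a..b}" if "x \<in> {a..b}" "s \<in> {0..1}" for x s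
  proof -
    have "s * (x - a) \<le> 1 * (x - a)" using that by (intro mult_right_mono) auto
    then show ?thesis using that by auto
  qed
  have gint: "g x integrable_on {0..1}" if "x \<in> {a..b}" for x
  proof -
    have "continuous_on {0..1} (\<lambda>s. f (a + s * (x - a)))"
      by (rule continuous_on_compose2[OF f]) (use that mem in \<open>auto intro!: continuous_intros\<close>)
    from absolutely_integrable_powr_left[OF \<kappa> this]
    show ?thesis unfolding g_def by (auto simp: absolutely_integrable_on_def)
  qed
  have eq: "integral {a..x} (\<lambda>t. (x - t) powr \<kappa> * f t) = (x - a) powr (\<kappa> + 1) * integral {0..1} (g x)"
    if x: "x \<in> {a..b}" for x
  proof (cases "x = a")
    case False
    then have xa: "a < x" using x by simp
    have "continuous_on {a..x} f" using f x by (auto intro: continuous_on_subset)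
    then have "integral {a..x} (\<lambda>t. (x - t) powr \<kappa> * f t) =
        (x - a) * integral {0..1} (\<lambda>s. (x - (a + s * (x - a))) powr \<kappa> * f (a + s * (x - a)))"
      using integral_unit_interval[of "\<lambda>t. (x - t) powr \<kappa> * f t" a x] xa
        absolutely_integrable_powr_left[OF \<kappa>] by (auto simp: absolutely_integrable_on_def)
    also have "integral {0..1} (\<lambda>s. (x - (a + s * (x - a))) powr \<kappa> * f (a + s * (x - a))) =
        integral {0..1} (\<lambda>s. (x - a) powr \<kappa> * g x s)"
    proof (rule integral_cong)
      fix s :: real assume "s \<in> {0..1}"
      have "x - (a + s * (x - a)) = (x - a) * (1 - s)" by (simp add: algebra_simps)
      then show "(x - (a + s * (x - a))) powr \<kappa> * f (a + s * (x - a)) = (x - a) powr \<kappa> * g x s"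
        using \<open>s \<in> {0..1}\<close> xa by (simp add: g_def powr_mult)
    qed
    also have "(x - a) * \<dots> = (x - a) powr (\<kappa> + 1) * integral {0..1} (g x)"
      using xa by (simp add: powr_add)
    finally show ?thesis .
  qed simp
  have "bounded (f ` {a..b})" using f by (intro compact_imp_bounded compact_continuous_image) auto
  then obtain B where B: "\<And>t. t \<in> {a..b} \<Longrightarrow> \<bar>f t\<bar> \<le> B" by (force simp: bounded_iff)
  have "continuous_on {a..b} (\<lambda>x. integral {0..1} (g x))"
    unfolding continuous_on_sequentially
  proof (intro allI ballI impI)
    fix X :: "nat \<Rightarrow> real" and x assume x: "x \<in> {a..b}" and X: "(\<forall>n. X n \<in> {a..b}) \<and> X \<longlonglongrightarrow> x"
    \<comment> \<open>The rescaled points stay in {a..b}, where f is bounded by B, so this majorant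
      serves for all n at once.\<close>
    have h: "(\<lambda>s. B * (1 - s) powr \<kappa>) integrable_on {0..1}"
      using has_integral_mult_right[OF has_integral_powr_left[OF \<kappa>, of 0 1], of B] by (auto simp: integrable_on_def)
    have "(\<lambda>n. integral {0..1} (g (X n))) \<longlonglongrightarrow> integral {0..1} (g x)"
    proof (rule dominated_convergence(2)[OF gint h])
      show "X n \<in> {a..b}" for n using X by auto
      show "norm (g (X n) s) \<le> B * (1 - s) powr \<kappa>" if "s \<in> {0..1}" for n s
        using B[OF mem[of "X n" s]] X that by (auto simp: g_def abs_mult mult.commute[of B] intro!: mult_left_mono)
      show "(\<lambda>n. g (X n) s) \<longlonglongrightarrow> g x s" if s: "s \<in> {0..1}" for s
      proof -
        have "(\<lambda>n. f (a + s * (X n - a))) \<longlonglongrightarrow> f (a + s * (x - a))"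
          by (rule continuous_on_tendsto_compose[OF f])
             (use X mem s x in \<open>auto intro!: tendsto_intros always_eventually\<close>)
        then show ?thesis unfolding g_def by (intro tendsto_intros)
      qed
    qed
    then show "((\<lambda>x. integral {0..1} (g x)) \<circ> X) \<longlonglongrightarrow> integral {0..1} (g x)" by (simp add: o_def)
  qed
  \<comment> \<open>At x = a the power is continuous because its exponent \<kappa> + 1 is
    positive.\<close>
  then have "continuous_on {a..b} (\<lambda>x. (x - a) powr (\<kappa> + 1) * integral {0..1} (g x))"
    using \<kappa> by (intro continuous_intros continuous_on_powr') auto
  then show ?thesis by (rule continuous_on_eq) (simp add: eq)
qed

lemma continuous_on_integral_powr_right:
  fixes a b \<kappa> :: real
  assumes \<kappa>: "\<kappa> > -1" and f: "continuous_on {a..b} f"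
  shows "continuous_on {a..b} (\<lambda>x. integral {x..b} (\<lambda>t. (t - x) powr \<kappa> * f t))"
proof -
  have c: "continuous_on {-b..-a} (\<lambda>t. f (-t))"
    by (rule continuous_on_compose2[OF f]) (auto intro!: continuous_intros)
  have "integral {-b..-x} (\<lambda>t. (- x - t) powr \<kappa> * f (- t)) = integral {x..b} (\<lambda>t. (t - x) powr \<kappa> * f t)" for x
    using Henstock_Kurzweil_Integration.integral_reflect_real[of b x "\<lambda>t. (t - x) powr \<kappa> * f t"]
    by (simp add: minus_diff_commute)
  moreover have "continuous_on {a..b} (\<lambda>x. integral {-b..-x} (\<lambda>t. (- x - t) powr \<kappa> * f (- t)))"
    by (rule continuous_on_compose2[OF continuous_on_integral_powr_left[OF \<kappa> c]])
       (auto intro!: continuous_intros)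
  ultimately show ?thesis by simp
qed

section \<open>Fubini's theorem for power kernels\<close>

lemma lborel_integral_on_interval:
  assumes "h absolutely_integrable_on {u..v::real}" "(\<lambda>x. indicator {u..v} x *\<^sub>R h x) \<in> borel_measurable borel"
  shows "integrable lborel (\<lambda>x. indicator {u..v} x *\<^sub>R (h x :: real))"
    and "(\<integral>x. indicator {u..v} x *\<^sub>R h x \<partial>lborel) = integral {u..v} h"
proof -
  \<comment> \<open>Absolute integrability refers to the completed Lebesgue measure, whereas
    Fubini's theorem will be applied to \<open>lborel\<close>. For a Borel measurable integrand the
    two notions agree.\<close>
  show i: "integrable lborel (\<lambda>x. indicator {u..v} x *\<^sub>R (h x :: real))"
    using assms unfolding set_integrable_def by (subst (asm) integrable_completion) auto
  then show "(\<integral>x. indicator {u..v} x *\<^sub>R h x \<partial>lborel) = integral {u..v} h"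
    using set_borel_integral_eq_integral(2)[of "{u..v}" h]
    by (simp add: set_integrable_def set_lebesgue_integral_def)
qed

lemma lborel_integral_powr_left:
  fixes a x \<kappa> :: real and g :: "real \<Rightarrow> real"
  assumes \<kappa>: "\<kappa> > -1" and g: "continuous_on {a..x} g"
  shows "integrable lborel (\<lambda>t. indicator {a..x} t *\<^sub>R ((x - t) powr \<kappa> * g t))"
    and "(\<integral>t. indicator {a..x} t *\<^sub>R ((x - t) powr \<kappa> * g t) \<partial>lborel) =
         integral {a..x} (\<lambda>t. (x - t) powr \<kappa> * g t)"
proof -
  have [measurable]: "(\<lambda>t. indicator {a..x} t *\<^sub>R g t) \<in> borel_measurable borel"
    by (intro borel_measurable_continuous_on_indicator g) simp
  \<comment> \<open>The indicator is attached to the continuous factor: extended by zero that factor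
    is Borel, and the kernel is Borel on the whole line.\<close>
  have "(\<lambda>t. (x - t) powr \<kappa> * (indicator {a..x} t *\<^sub>R g t)) \<in> borel_measurable borel" by measurable
  then have "(\<lambda>t. indicator {a..x} t *\<^sub>R ((x - t) powr \<kappa> * g t)) \<in> borel_measurable borel"
    by (simp add: mult.left_commute)
  from lborel_integral_on_interval[OF absolutely_integrable_powr_left[OF \<kappa> g] this]
  show "integrable lborel (\<lambda>t. indicator {a..x} t *\<^sub>R ((x - t) powr \<kappa> * g t))"
    and "(\<integral>t. indicator {a..x} t *\<^sub>R ((x - t) powr \<kappa> * g t) \<partial>lborel) =
         integral {a..x} (\<lambda>t. (x - t) powr \<kappa> * g t)" .
qed

lemma lborel_integral_powr_right:
  fixes b x \<kappa> :: real and g :: "real \<Rightarrow> real"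
  assumes \<kappa>: "\<kappa> > -1" and g: "continuous_on {x..b} g"
  shows "(\<integral>t. indicator {x..b} t *\<^sub>R ((t - x) powr \<kappa> * g t) \<partial>lborel) =
         integral {x..b} (\<lambda>t. (t - x) powr \<kappa> * g t)"
proof -
  have [measurable]: "(\<lambda>t. indicator {x..b} t *\<^sub>R g t) \<in> borel_measurable borel"
    by (intro borel_measurable_continuous_on_indicator g) simp
  have "(\<lambda>t. (t - x) powr \<kappa> * (indicator {x..b} t *\<^sub>R g t)) \<in> borel_measurable borel" by measurable
  then have "(\<lambda>t. indicator {x..b} t *\<^sub>R ((t - x) powr \<kappa> * g t)) \<in> borel_measurable borel"
    by (simp add: mult.left_commute)
  from lborel_integral_on_interval(2)[OF absolutely_integrable_powr_right[OF \<kappa> g] this] show ?thesis .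
qed

lemma lborel_integral_continuous:
  assumes g: "continuous_on {a..b::real} g"
  shows "integrable lborel (\<lambda>x. indicator {a..b} x *\<^sub>R (g x :: real))"
    and "(\<integral>x. indicator {a..b} x *\<^sub>R g x \<partial>lborel) = integral {a..b} g"
proof -
  have "(\<lambda>x. indicator {a..b} x *\<^sub>R g x) \<in> borel_measurable borel"
    by (intro borel_measurable_continuous_on_indicator g) simp
  from lborel_integral_on_interval[OF absolutely_integrable_continuous_real[OF g] this]
  show "integrable lborel (\<lambda>x. indicator {a..b} x *\<^sub>R (g x :: real))"
    and "(\<integral>x. indicator {a..b} x *\<^sub>R g x \<partial>lborel) = integral {a..b} g" .
qed

text \<open>Both sides integrate the same function over the triangle a \<le> t \<le> x \<le> b. With
  exponents \<beta> - 1 and - \<alpha> this is the fractional integration by parts that turns left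
  operators into right ones.\<close>

lemma integral_powr_swap:
  fixes f g :: "real \<Rightarrow> real"
  assumes \<kappa>: "\<kappa> > -1"
    and f: "continuous_on {a..b} f" and g: "continuous_on {a..b} g"
  shows "integral {a..b} (\<lambda>x. f x * integral {a..x} (\<lambda>t. (x - t) powr \<kappa> * g t)) =
         integral {a..b} (\<lambda>t. g t * integral {t..b} (\<lambda>x. (x - t) powr \<kappa> * f x))"
proof -
  define F where "F x = indicator {a..b} x *\<^sub>R f x" for x
  define G where "G x = indicator {a..b} x *\<^sub>R g x" for x
  \<comment> \<open>The triangle is encoded by the indicators in \<open>F\<close> and
    \<open>G\<close> and by t \<le> x, which keeps \<open>k\<close> jointly Borel. The forms
    \<open>k1\<close> and \<open>k2\<close> below are adapted to the two orders of
    integration.\<close>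
  define k where "k x t = F x * G t * ((if t \<le> x then 1 else 0) * (x - t) powr \<kappa>)" for x t
  have [measurable]: "F \<in> borel_measurable borel" "G \<in> borel_measurable borel"
    unfolding F_def G_def by (intro borel_measurable_continuous_on_indicator f g; simp)+
  have km: "case_prod k \<in> borel_measurable (lborel \<Otimes>\<^sub>M lborel)"
    unfolding k_def by measurable
  have k1: "k x t = indicator {a..b} x *\<^sub>R (f x * (indicator {a..x} t *\<^sub>R ((x - t) powr \<kappa> * g t)))" for x t
    by (auto simp: k_def F_def G_def indicator_def)
  have k2: "k x t = indicator {a..b} t *\<^sub>R (g t * (indicator {t..b} x *\<^sub>R ((x - t) powr \<kappa> * f x)))" for x t
    by (auto simp: k_def F_def G_def indicator_def)
  have cl: "continuous_on {a..x} h" if "x \<in> {a..b}" "continuous_on {a..b} h" for x and h :: "real \<Rightarrow> real"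
    using that by (auto intro: continuous_on_subset)
  have cr: "continuous_on {x..b} f" if "x \<in> {a..b}" for x using f that by (auto intro: continuous_on_subset)
  have g': "continuous_on {a..b} (\<lambda>x. \<bar>g x\<bar>)" using g by (intro continuous_intros)
  have I1: "(\<integral>t. k x t \<partial>lborel) = indicator {a..b} x *\<^sub>R (f x * integral {a..x} (\<lambda>t. (x - t) powr \<kappa> * g t))" for x
  proof (cases "x \<in> {a..b}")
    case True
    show ?thesis unfolding k1 using lborel_integral_powr_left[OF \<kappa> cl[OF True g]] by simp
  qed (simp only: k1, simp)
  have I2: "(\<integral>x. k x t \<partial>lborel) = indicator {a..b} t *\<^sub>R (g t * integral {t..b} (\<lambda>x. (x - t) powr \<kappa> * f x))" for t
  proof (cases "t \<in> {a..b}")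
    case True
    show ?thesis unfolding k2 using lborel_integral_powr_right[OF \<kappa> cr[OF True]] by simp
  qed (simp only: k2, simp)
  have absk: "norm (k x t) = indicator {a..b} x *\<^sub>R (\<bar>f x\<bar> * (indicator {a..x} t *\<^sub>R ((x - t) powr \<kappa> * \<bar>g t\<bar>)))" for x t
    unfolding k1 by (simp add: abs_mult)
  have I3: "(\<integral>t. norm (k x t) \<partial>lborel) =
      indicator {a..b} x *\<^sub>R (\<bar>f x\<bar> * integral {a..x} (\<lambda>t. (x - t) powr \<kappa> * \<bar>g t\<bar>))" for x
  proof (cases "x \<in> {a..b}")
    case True
    show ?thesis unfolding absk using lborel_integral_powr_left[OF \<kappa> cl[OF True g']] by simp
  qed (simp only: absk, simp)
  have "integrable (lborel \<Otimes>\<^sub>M lborel) (case_prod k)"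
  proof (rule lborel_pair.Fubini_integrable[OF km])
    \<comment> \<open>By \<open>I3\<close> this is the inner integral of the absolute value of
      \<open>k\<close>; being continuous in the outer variable, it is integrable on {a..b}.\<close>
    have "continuous_on {a..b} (\<lambda>x. \<bar>f x\<bar> * integral {a..x} (\<lambda>t. (x - t) powr \<kappa> * \<bar>g t\<bar>))"
      by (intro continuous_intros f continuous_on_integral_powr_left \<kappa> g')
    from lborel_integral_continuous(1)[OF this]
    show "integrable lborel (\<lambda>x. \<integral>t. norm (case (x, t) of (x, t) \<Rightarrow> k x t) \<partial>lborel)"
      by (simp only: I3 prod.case)
    have "integrable lborel (\<lambda>t. k x t)" for x
    proof (cases "x \<in> {a..b}")
      case True
      show ?thesis unfolding k1
        by (intro integrable_scaleR_right integrable_mult_right impI lborel_integral_powr_left(1)[OF \<kappa> cl[OF True g]])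
    qed (simp only: k1, simp)
    then show "AE x in lborel. integrable lborel (\<lambda>t. case (x, t) of (x, t) \<Rightarrow> k x t)" by simp
  qed
  from lborel_pair.Fubini_integral[OF this]
  have "(\<integral>t. (\<integral>x. k x t \<partial>lborel) \<partial>lborel) = (\<integral>x. (\<integral>t. k x t \<partial>lborel) \<partial>lborel)" .
  moreover have "continuous_on {a..b} (\<lambda>x. f x * integral {a..x} (\<lambda>t. (x - t) powr \<kappa> * g t))"
    by (intro continuous_intros f continuous_on_integral_powr_left \<kappa> g)
  moreover have "continuous_on {a..b} (\<lambda>t. g t * integral {t..b} (\<lambda>x. (x - t) powr \<kappa> * f x))"
    by (intro continuous_intros g continuous_on_integral_powr_right \<kappa> f)
  ultimately show ?thesis
    unfolding I1 I2 by (simp only: lborel_integral_continuous(2))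
qed

subsection \<open>Two-parameter families\<close>

text \<open>Joint continuity of the derivative, taken in the operator norm, is what differentiation
  under the integral requires, and it survives composition and integration. The functional can thus
  be differentiated one layer of its construction at a time.\<close>

definition smooth_family ::
  "real \<Rightarrow> real \<Rightarrow> ('p::real_normed_vector \<Rightarrow> real \<Rightarrow> 'e::real_normed_vector) \<Rightarrow>
   ('p \<Rightarrow> real \<Rightarrow> 'p \<Rightarrow>\<^sub>L 'e) \<Rightarrow> bool" where
  "smooth_family a b q q' \<longleftrightarrow>
     (\<forall>c. \<forall>x\<in>{a..b}. ((\<lambda>c. q c x) has_derivative blinfun_apply (q' c x)) (at c)) \<and>
     continuous_on (UNIV \<times> {a..b}) (\<lambda>(c, x). q c x) \<and>
     continuous_on (UNIV \<times> {a..b}) (\<lambda>(c, x). q' c x)"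

lemma continuous_on_section:
  assumes "continuous_on (UNIV \<times> {a..b}) (\<lambda>(c, x). q c x)"
  shows "continuous_on {a..b} (q c)"
proof -
  have "continuous_on {a..b} (\<lambda>x. (\<lambda>(c, x). q c x) (c, x))"
    by (rule continuous_on_compose2[OF assms]) (auto intro!: continuous_intros)
  then show ?thesis by simp
qed

text \<open>The chain rule with an outer function that is differentiable only relative to S. This
  suffices because the family never leaves S.\<close>

lemma smooth_family_compose:
  assumes P: "smooth_family a b P P'" and PS: "\<And>c x. x \<in> {a..b} \<Longrightarrow> P c x \<in> S"
    and f: "\<And>p. p \<in> S \<Longrightarrow> (f has_derivative blinfun_apply (f' p)) (at p within S)"
    and f': "continuous_on S f'"
  shows "smooth_family a b (\<lambda>c x. f (P c x)) (\<lambda>c x. f' (P c x) o\<^sub>L P' c x)"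
proof -
  have d: "((\<lambda>c. P c x) has_derivative blinfun_apply (P' c x)) (at c)" if "x \<in> {a..b}" for c x
    using P that by (auto simp: smooth_family_def)
  have c: "continuous_on (UNIV \<times> {a..b}) (\<lambda>p. P (fst p) (snd p))"
    "continuous_on (UNIV \<times> {a..b}) (\<lambda>p. P' (fst p) (snd p))"
    using P by (auto simp: smooth_family_def case_prod_beta')
  have cf: "continuous_on S f"
    using f by (meson continuous_on_eq_continuous_within has_derivative_continuous)
  have "((\<lambda>c. f (P c x)) has_derivative blinfun_apply (f' (P c x) o\<^sub>L P' c x)) (at c)"
    if x: "x \<in> {a..b}" for c x
  proof -
    have "((\<lambda>c. f (P c x)) has_derivative (\<lambda>h. blinfun_apply (f' (P c x)) (P' c x h))) (at c)"
      by (rule has_derivative_in_compose2[where s = UNIV and t = S, OF f _ _ d[OF x]])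
        (use PS x in auto)
    then show ?thesis by (simp add: blinfun_compose.rep_eq o_def)
  qed
  moreover have "continuous_on (UNIV \<times> {a..b}) (\<lambda>(c, x). f (P c x))"
    unfolding case_prod_beta'
    by (rule continuous_on_compose2[OF cf c(1)]) (use PS in auto)
  moreover have "continuous_on (UNIV \<times> {a..b}) (\<lambda>(c, x). f' (P c x) o\<^sub>L P' c x)"
    unfolding case_prod_beta'
    by (intro bounded_bilinear.continuous_on[OF bounded_bilinear_blinfun_compose] c
        continuous_on_compose2[OF f' c(1)]) (use PS in auto)
  ultimately show ?thesis unfolding smooth_family_def by blast
qed

lemma smooth_family_add:
  assumes "smooth_family a b P P'" "smooth_family a b Q Q'"
  shows "smooth_family a b (\<lambda>c x. P c x + Q c x) (\<lambda>c x. P' c x + Q' c x)"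
  using assms unfolding smooth_family_def case_prod_beta'
  by (auto intro!: continuous_intros derivative_eq_intros simp: blinfun.add_left)

lemma smooth_family_linear:
  assumes "smooth_family a b P P'"
  shows "smooth_family a b (\<lambda>c x. blinfun_apply A (P c x)) (\<lambda>c x. A o\<^sub>L P' c x)"
  by (rule smooth_family_compose[where S = UNIV, OF assms])
    (auto intro: bounded_linear_imp_has_derivative blinfun.bounded_linear_right)

text \<open>After rescaling to the unit interval, the upper limit x becomes a parameter of the
  integrand on the same footing as c, and continuity of parameter integrals over a fixed interval
  applies.\<close>

lemma continuous_on_integral_upto:
  fixes f :: "'p::topological_space \<Rightarrow> real \<Rightarrow> 'c::banach"
  assumes f: "continuous_on (UNIV \<times> {a..b}) (\<lambda>(c, x). f c x)"
  shows "continuous_on (UNIV \<times> {a..b}) (\<lambda>(c, x). integral {a..x} (f c))"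
proof -
  have mem: "a + s * (x - a) \<in> {a..b}" if "x \<in> {a..b}" "s \<in> {0..1}" for x s
  proof -
    have "s * (x - a) \<le> 1 * (x - a)" using that by (intro mult_right_mono) auto
    then show ?thesis using that by auto
  qed
  define g where "g p s = f (fst p) (a + s * (snd p - a))" for p :: "'p \<times> real" and s
  have "continuous_on ((UNIV \<times> {a..b}) \<times> cbox 0 1)
      (\<lambda>r. (\<lambda>(c, x). f c x) (fst (fst r), a + snd r * (snd (fst r) - a)))"
    by (rule continuous_on_compose2[OF f]) (use mem in \<open>auto intro!: continuous_intros\<close>)
  then have "continuous_on ((UNIV \<times> {a..b}) \<times> cbox 0 1) (\<lambda>(p, s). g p s)"
    by (simp add: g_def case_prod_beta')
  from integral_continuous_on_param[OF this]
  have "continuous_on (UNIV \<times> {a..b}) (\<lambda>p. (snd p - a) *\<^sub>R integral {0..1} (g p))"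
    by (intro continuous_intros) auto
  moreover have "(snd p - a) *\<^sub>R integral {0..1} (g p) = (\<lambda>(c, x). integral {a..x} (f c)) p"
    if "p \<in> UNIV \<times> {a..b}" for p
  proof -
    have "continuous_on {a..snd p} (f (fst p))"
      using that by (auto intro!: continuous_on_subset[OF continuous_on_section[OF f]])
    then have "f (fst p) integrable_on {a..snd p}" by (rule integrable_continuous_real)
    from integral_unit_interval[OF this] that show ?thesis by (auto simp: g_def[abs_def] case_prod_beta')
  qed
  ultimately show ?thesis by (rule continuous_on_eq)
qed

text \<open>The Leibniz rule at each fixed upper limit; the derivative is an integral of linear
  maps, whose continuity in both variables is \<open>continuous_on_integral_upto\<close>.\<close>

lemma smooth_family_integral:
  fixes q :: "'p::banach \<Rightarrow> real \<Rightarrow> 'c::banach"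
  assumes q: "smooth_family a b q q'"
  shows "smooth_family a b (\<lambda>c x. integral {a..x} (q c)) (\<lambda>c x. integral {a..x} (q' c))"
proof -
  have c: "continuous_on (UNIV \<times> {a..b}) (\<lambda>(c, x). q c x)"
    "continuous_on (UNIV \<times> {a..b}) (\<lambda>(c, x). q' c x)"
    using q by (auto simp: smooth_family_def)
  have "((\<lambda>c. integral (cbox a x) (q c)) has_derivative blinfun_apply (integral (cbox a x) (q' c))) (at c within UNIV)"
    if x: "x \<in> {a..b}" for c x
  proof (rule leibniz_rule)
    show "((\<lambda>c. q c t) has_derivative blinfun_apply (q' c t)) (at c within UNIV)" if "t \<in> cbox a x" for c t
      using q that x by (auto simp: smooth_family_def)
    show "q c integrable_on cbox a x" for c
      using x by (auto intro!: integrable_continuous_real continuous_on_subset[OF continuous_on_section[OF c(1)]])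
    show "continuous_on (UNIV \<times> cbox a x) (\<lambda>(x, t). q' x t)"
      by (rule continuous_on_subset[OF c(2)]) (use x in auto)
  qed auto
  then show ?thesis
    using c by (auto simp: smooth_family_def intro: continuous_on_integral_upto)
qed

lemma bounded_linear_two_param:
  "bounded_linear (\<lambda>c :: real \<times> real. fst c *\<^sub>R u + snd c *\<^sub>R v)"
  by (intro bounded_linear_intros)

text \<open>Projections instead of a pattern make it visibly linear, so that the chain rule can
  treat it as a sum of two bounded linear maps.\<close>

definition with_z :: "real \<times> real \<times> real \<times> real \<Rightarrow> real \<Rightarrow> real \<times> real \<times> real \<times> real \<times> real" where
  "with_z p z = (fst p, fst (snd p), fst (snd (snd p)), snd (snd (snd p)), z)"

lemma with_z_split:
  obtains A :: "(real \<times> real \<times> real \<times> real) \<Rightarrow>\<^sub>L (real \<times> real \<times> real \<times> real \<times> real)"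
    and B :: "real \<Rightarrow>\<^sub>L (real \<times> real \<times> real \<times> real \<times> real)"
  where "\<And>p z. with_z p z = blinfun_apply A p + blinfun_apply B z"
proof
  have A: "bounded_linear (\<lambda>p. with_z p 0)" and B: "bounded_linear (\<lambda>z. with_z 0 z)"
    unfolding with_z_def
    by (intro bounded_linear_Pair bounded_linear_zero bounded_linear_ident bounded_linear_fst
        bounded_linear_fst_comp bounded_linear_snd_comp; simp)+
  show "with_z p z = blinfun_apply (Blinfun (\<lambda>p. with_z p 0)) p + blinfun_apply (Blinfun (\<lambda>z. with_z 0 z)) z" for p z
    by (simp add: bounded_linear_Blinfun_apply A B) (simp add: with_z_def)
qed

text \<open>The part of the argument that is free of fractional operators: a continuous curve
  \<open>J\<close> is displaced affinely in two directions. These have zero first component, so the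
  independent variable is not varied and the displaced curve stays in X \<times> UNIV, where
  \<open>l\<close> and \<open>K\<close> are differentiable. Continuity everywhere and the derivative
  at 0 are what \<open>two_param_multiplier\<close> asks for.\<close>

lemma two_param_functional_derivative:
  fixes J v w :: "real \<Rightarrow> real \<times> real \<times> real \<times> real"
    and l :: "real \<times> real \<times> real \<times> real \<Rightarrow> real" and K :: "real \<times> real \<times> real \<times> real \<times> real \<Rightarrow> real"
    and a b :: real
  defines "P \<equiv> \<lambda>c x. J x + (fst c *\<^sub>R v x + snd c *\<^sub>R w x)"
  defines "Z \<equiv> \<lambda>c x. integral {a..x} (\<lambda>t. l (P c t))"
  defines "\<Phi> \<equiv> \<lambda>c. integral {a..b} (\<lambda>x. K (with_z (P c x) (Z c x)))"
  assumes ab: "a \<le> b"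
    and cont: "continuous_on {a..b} J" "continuous_on {a..b} v" "continuous_on {a..b} w"
    and fst: "\<And>x. x \<in> {a..b} \<Longrightarrow> fst (J x) \<in> X" "\<And>x. fst (v x) = 0" "\<And>x. fst (w x) = 0"
    and l: "\<And>p. p \<in> X \<times> UNIV \<Longrightarrow> (l has_derivative blinfun_apply (l' p)) (at p within X \<times> UNIV)"
      "continuous_on (X \<times> UNIV) l'"
    and K: "\<And>p. p \<in> X \<times> UNIV \<Longrightarrow> (K has_derivative blinfun_apply (K' p)) (at p within X \<times> UNIV)"
      "continuous_on (X \<times> UNIV) K'"
  shows "continuous_on UNIV \<Phi>"
    and "(\<Phi> has_derivative (\<lambda>c. integral {a..b} (\<lambda>x. K' (with_z (J x) (integral {a..x} (\<lambda>t. l (J t))))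
            (with_z (fst c *\<^sub>R v x + snd c *\<^sub>R w x)
               (integral {a..x} (\<lambda>t. l' (J t) (fst c *\<^sub>R v t + snd c *\<^sub>R w t))))))) (at 0)"
proof -
  obtain A :: "(real \<times> real \<times> real \<times> real) \<Rightarrow>\<^sub>L (real \<times> real \<times> real \<times> real \<times> real)"
    and B :: "real \<Rightarrow>\<^sub>L (real \<times> real \<times> real \<times> real \<times> real)"
    where AB: "\<And>p z. with_z p z = blinfun_apply A p + blinfun_apply B z" using with_z_split by blast
  define P' :: "real \<times> real \<Rightarrow> real \<Rightarrow> (real \<times> real) \<Rightarrow>\<^sub>L _"
    where "P' c x = Blinfun (\<lambda>c. fst c *\<^sub>R v x + snd c *\<^sub>R w x)" for c x
  have P'[simp]: "blinfun_apply (P' c x) d = fst d *\<^sub>R v x + snd d *\<^sub>R w x" for c x d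
    by (simp add: P'_def bounded_linear_Blinfun_apply bounded_linear_two_param)
  have cs: "continuous_on (UNIV \<times> {a..b}) (\<lambda>p :: (real \<times> real) \<times> real. f (snd p))"
    if "continuous_on {a..b} f" for f :: "real \<Rightarrow> real \<times> real \<times> real \<times> real"
    by (rule continuous_on_compose2[OF that]) (auto intro!: continuous_intros)
  have P: "smooth_family a b P P'"
    unfolding smooth_family_def
  proof (intro conjI allI ballI)
    show "((\<lambda>c. P c x) has_derivative blinfun_apply (P' c x)) (at c)" for c x
    proof -
      have "((\<lambda>c. P c x) has_derivative (\<lambda>d. fst d *\<^sub>R v x + snd d *\<^sub>R w x)) (at c)"
        unfolding P_def by (auto intro!: derivative_eq_intros)
      then show ?thesis by (simp add: fun_eq_iff[symmetric] P'[abs_def])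
    qed
    show "continuous_on (UNIV \<times> {a..b}) (\<lambda>(c, x). P c x)"
      unfolding P_def case_prod_beta' by (intro continuous_intros cs cont)
    show "continuous_on (UNIV \<times> {a..b}) (\<lambda>(c, x). P' c x)"
      unfolding case_prod_beta'
      by (intro continuous_on_blinfun_componentwise) (auto intro!: continuous_intros cs cont)
  qed
  have PX: "P c x \<in> X \<times> UNIV" if "x \<in> {a..b}" for c x
    using fst that by (auto simp: P_def mem_Times_iff)
  have Z: "smooth_family a b Z (\<lambda>c x. integral {a..x} (\<lambda>t. l' (P c t) o\<^sub>L P' c t))"
    unfolding Z_def by (intro smooth_family_integral smooth_family_compose[OF P PX l])
  let ?Z' = "\<lambda>c x. integral {a..x} (\<lambda>t. l' (P c t) o\<^sub>L P' c t)"
  have jz: "smooth_family a b (\<lambda>c x. with_z (P c x) (Z c x)) (\<lambda>c x. (A o\<^sub>L P' c x) + (B o\<^sub>L ?Z' c x))"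
    unfolding AB by (intro smooth_family_add smooth_family_linear P Z)
  have WX: "with_z (P c x) (Z c x) \<in> X \<times> UNIV" if "x \<in> {a..b}" for c x
    using PX[OF that] by (auto simp: with_z_def mem_Times_iff)
  have Kf: "smooth_family a b (\<lambda>c x. K (with_z (P c x) (Z c x)))
      (\<lambda>c x. K' (with_z (P c x) (Z c x)) o\<^sub>L ((A o\<^sub>L P' c x) + (B o\<^sub>L ?Z' c x)))"
    by (rule smooth_family_compose[OF jz WX K])
  \<comment> \<open>The functional is the integral of the smooth family \<open>Kf\<close> up to the
    limit b.\<close>
  have dPhi: "(\<Phi> has_derivative blinfun_apply (integral {a..b}
      (\<lambda>x. K' (with_z (P c x) (Z c x)) o\<^sub>L ((A o\<^sub>L P' c x) + (B o\<^sub>L ?Z' c x))))) (at c)" for c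
    using smooth_family_integral[OF Kf, unfolded smooth_family_def, THEN conjunct1, rule_format, of b c] ab
    unfolding \<Phi>_def by simp
  show "continuous_on UNIV \<Phi>"
    using dPhi by (intro continuous_at_imp_continuous_on) (auto intro: has_derivative_continuous)
  have P0: "P 0 x = J x" for x by (simp add: P_def)
  have sec: "continuous_on {a..b} (\<lambda>t. l' (P c t) o\<^sub>L P' c t)" for c
    using smooth_family_compose[OF P PX l] continuous_on_section
    by (auto simp: smooth_family_def)
  \<comment> \<open>The derivatives obtained so far are integrals of linear maps. Evaluating them at
    c commutes with integration and gives the scalar formula.\<close>
  have Z'app: "blinfun_apply (?Z' 0 x) c = integral {a..x} (\<lambda>t. l' (J t) (fst c *\<^sub>R v t + snd c *\<^sub>R w t))"
    if "x \<in> {a..b}" for x c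
  proof -
    have "(\<lambda>t. l' (P 0 t) o\<^sub>L P' 0 t) integrable_on {a..x}"
      using that by (auto intro!: integrable_continuous_real continuous_on_subset[OF sec])
    then show ?thesis by (subst blinfun_apply_integral) (auto simp: P0)
  qed
  have "continuous_on {a..b} (\<lambda>x. K' (with_z (P c x) (Z c x)) o\<^sub>L ((A o\<^sub>L P' c x) + (B o\<^sub>L ?Z' c x)))" for c
    using Kf continuous_on_section by (auto simp: smooth_family_def)
  then have "(\<lambda>x. K' (with_z (P 0 x) (Z 0 x)) o\<^sub>L ((A o\<^sub>L P' 0 x) + (B o\<^sub>L ?Z' 0 x))) integrable_on {a..b}"
    by (rule integrable_continuous_real)
  note app = blinfun_apply_integral[OF this]
  have "blinfun_apply (integral {a..b}
      (\<lambda>x. K' (with_z (P 0 x) (Z 0 x)) o\<^sub>L ((A o\<^sub>L P' 0 x) + (B o\<^sub>L ?Z' 0 x)))) =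
    (\<lambda>c. integral {a..b} (\<lambda>x. K' (with_z (J x) (integral {a..x} (\<lambda>t. l (J t))))
            (with_z (fst c *\<^sub>R v x + snd c *\<^sub>R w x)
               (integral {a..x} (\<lambda>t. l' (J t) (fst c *\<^sub>R v t + snd c *\<^sub>R w t))))))"
    unfolding app
    by (intro ext integral_cong)
      (simp only: blinfun_apply_blinfun_compose blinfun.add_left Z'app P' AB, simp only: P0 Z_def)
  then show "(\<Phi> has_derivative (\<lambda>c. integral {a..b} (\<lambda>x. K' (with_z (J x) (integral {a..x} (\<lambda>t. l (J t))))
            (with_z (fst c *\<^sub>R v x + snd c *\<^sub>R w x)
               (integral {a..x} (\<lambda>t. l' (J t) (fst c *\<^sub>R v t + snd c *\<^sub>R w t))))))) (at 0)"
    using dPhi[of 0] by simp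
qed

subsection \<open>Admissible variations\<close>

text \<open>The derivative is two-sided at the end points because \<^const>\<open>caputo_left\<close> is defined with
  \<^const>\<open>deriv\<close>.\<close>

definition primitive_on :: "real \<Rightarrow> real \<Rightarrow> (real \<Rightarrow> real) \<Rightarrow> (real \<Rightarrow> real) \<Rightarrow> bool" where
  "primitive_on a b g h \<longleftrightarrow>
     (\<forall>t\<in>{a..b}. (h has_real_derivative g t) (at t)) \<and> continuous_on {a..b} g"

lemma primitive_on_combine:
  assumes "primitive_on a b g1 h1" "primitive_on a b g2 h2"
  shows "primitive_on a b (\<lambda>t. r * g1 t + s * g2 t) (\<lambda>t. r * h1 t + s * h2 t)"
  using assms unfolding primitive_on_def
  by (auto intro!: continuous_intros derivative_eq_intros)

lemma primitive_on_continuous: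
  assumes "primitive_on a b g h"
  shows "continuous_on {a..b} h"
  using assms unfolding primitive_on_def
  by (intro continuous_at_imp_continuous_on ballI) (auto intro: DERIV_isCont)

lemma primitive_exists:
  assumes "a \<le> b" "continuous_on {a..b} g"
  obtains h where "primitive_on a b g h" "h a = 0" "h b = integral {a..b} g"
proof -
  \<comment> \<open>The continuous extension of g beyond {a..b}, together with integration from a -
    1, places both end points in the interior of an interval, so the primitive has two-sided
    derivatives there.\<close>
  define G where "G = ext_cont g a b"
  have G: "continuous_on S G" for S using assms(2) unfolding G_def by (intro continuous_on_ext_cont) simp
  have Gg: "G t = g t" if "t \<in> {a..b}" for t using that by (simp add: G_def)
  have Gi: "G integrable_on {u..v}" for u v by (intro integrable_continuous_real G)
  define h where "h x = integral {a - 1..x} G - integral {a - 1..a} G" for x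
  show thesis
  proof
    show "primitive_on a b g h" unfolding primitive_on_def
    proof (intro conjI ballI assms)
      fix t assume t: "t \<in> {a..b}"
      have "((\<lambda>x. integral {a - 1..x} G) has_real_derivative G t) (at t within {a - 1..b + 1})"
        using t by (intro integral_has_real_derivative G) auto
      moreover have "at t within {a - 1..b + 1} = at t"
        using t by (intro at_within_interior) simp
      ultimately have "((\<lambda>x. integral {a - 1..x} G) has_real_derivative g t) (at t)"
        using Gg[OF t] by simp
      from DERIV_diff[OF this DERIV_const[of "integral {a - 1..a} G"]]
      show "(h has_real_derivative g t) (at t)"
        unfolding h_def by simp
    qed
    show "h a = 0" by (simp add: h_def)
    have "integral {a - 1..b} G = integral {a - 1..a} G + integral {a..b} G"
      using assms(1) Gi by (simp add: Henstock_Kurzweil_Integration.integral_combine)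
    also have "integral {a..b} G = integral {a..b} g" by (rule integral_cong) (simp add: Gg)
    finally show "h b = integral {a..b} g" by (simp add: h_def)
  qed
qed

section \<open>Absolute continuity\<close>

lemma abs_continuous_on_interval_lipschitz:
  assumes "\<And>u v. a \<le> u \<Longrightarrow> u \<le> v \<Longrightarrow> v \<le> b \<Longrightarrow> \<bar>h v - h u\<bar> \<le> B * (v - u)"
  shows "abs_continuous_on_interval a b h"
  unfolding abs_continuous_on_interval_def
proof (intro allI impI)
  fix \<epsilon> :: real assume \<epsilon>: "\<epsilon> > 0"
  show "\<exists>\<delta>>0. \<forall>P :: (real \<times> real) set.
        finite P \<longrightarrow> (\<forall>(u, v)\<in>P. a \<le> u \<and> u \<le> v \<and> v \<le> b) \<longrightarrow>
        disjoint_family_on (\<lambda>(u, v). {u<..<v}) P \<longrightarrow>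
        (\<Sum>(u, v)\<in>P. v - u) < \<delta> \<longrightarrow> (\<Sum>(u, v)\<in>P. \<bar>h v - h u\<bar>) < \<epsilon>"
  \<comment> \<open>The sign of B is not known, and B may be zero; \<bar>B\<bar> + 1 is a positive
    Lipschitz constant in every case.\<close>
  proof (intro exI[of _ "\<epsilon> / (\<bar>B\<bar> + 1)"] conjI allI impI)
    show "\<epsilon> / (\<bar>B\<bar> + 1) > 0" using \<epsilon> by simp
    fix P :: "(real \<times> real) set"
    assume P: "finite P" "\<forall>(u, v)\<in>P. a \<le> u \<and> u \<le> v \<and> v \<le> b"
      and s: "(\<Sum>(u, v)\<in>P. v - u) < \<epsilon> / (\<bar>B\<bar> + 1)"
    have "(\<Sum>(u, v)\<in>P. \<bar>h v - h u\<bar>) \<le> (\<Sum>(u, v)\<in>P. (\<bar>B\<bar> + 1) * (v - u))"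
    proof (rule sum_mono, clarify)
      fix u v assume "(u, v) \<in> P"
      then have "a \<le> u" "u \<le> v" "v \<le> b" using P by auto
      then have "\<bar>h v - h u\<bar> \<le> B * (v - u)" by (rule assms)
      also have "\<dots> \<le> (\<bar>B\<bar> + 1) * (v - u)" using \<open>u \<le> v\<close> by (intro mult_right_mono) auto
      finally show "\<bar>h v - h u\<bar> \<le> (\<bar>B\<bar> + 1) * (v - u)" .
    qed
    also have "\<dots> = (\<bar>B\<bar> + 1) * (\<Sum>(u, v)\<in>P. v - u)" by (simp add: sum_distrib_left case_prod_beta')
    also have "\<dots> < (\<bar>B\<bar> + 1) * (\<epsilon> / (\<bar>B\<bar> + 1))" using s by (intro mult_strict_left_mono) auto
    also have "\<dots> = \<epsilon>" by simp
    finally show "(\<Sum>(u, v)\<in>P. \<bar>h v - h u\<bar>) < \<epsilon>" .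
  qed
qed

lemma abs_continuous_on_interval_add:
  assumes f: "abs_continuous_on_interval a b f" and g: "abs_continuous_on_interval a b g"
  shows "abs_continuous_on_interval a b (\<lambda>t. f t + g t)"
  unfolding abs_continuous_on_interval_def
proof (intro allI impI)
  fix \<epsilon> :: real assume "\<epsilon> > 0"
  then have \<epsilon>: "\<epsilon> / 2 > 0" by simp
  obtain d where d: "d > 0" "\<And>P. finite P \<Longrightarrow> (\<forall>(u, v)\<in>P. a \<le> u \<and> u \<le> v \<and> v \<le> b) \<Longrightarrow>
        disjoint_family_on (\<lambda>(u, v). {u<..<v}) P \<Longrightarrow>
        (\<Sum>(u, v)\<in>P. v - u) < d \<Longrightarrow> (\<Sum>(u, v)\<in>P. \<bar>f v - f u\<bar>) < \<epsilon> / 2"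
    using f[unfolded abs_continuous_on_interval_def, rule_format, OF \<epsilon>] by blast
  obtain e where e: "e > 0" "\<And>P. finite P \<Longrightarrow> (\<forall>(u, v)\<in>P. a \<le> u \<and> u \<le> v \<and> v \<le> b) \<Longrightarrow>
        disjoint_family_on (\<lambda>(u, v). {u<..<v}) P \<Longrightarrow>
        (\<Sum>(u, v)\<in>P. v - u) < e \<Longrightarrow> (\<Sum>(u, v)\<in>P. \<bar>g v - g u\<bar>) < \<epsilon> / 2"
    using g[unfolded abs_continuous_on_interval_def, rule_format, OF \<epsilon>] by blast
  show "\<exists>\<delta>>0. \<forall>P :: (real \<times> real) set.
        finite P \<longrightarrow> (\<forall>(u, v)\<in>P. a \<le> u \<and> u \<le> v \<and> v \<le> b) \<longrightarrow>
        disjoint_family_on (\<lambda>(u, v). {u<..<v}) P \<longrightarrow>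
        (\<Sum>(u, v)\<in>P. v - u) < \<delta> \<longrightarrow> (\<Sum>(u, v)\<in>P. \<bar>f v + g v - (f u + g u)\<bar>) < \<epsilon>"
  proof (intro exI[of _ "min d e"] conjI allI impI)
    show "min d e > 0" using d e by simp
    fix P :: "(real \<times> real) set"
    assume P: "finite P" "\<forall>(u, v)\<in>P. a \<le> u \<and> u \<le> v \<and> v \<le> b"
      "disjoint_family_on (\<lambda>(u, v). {u<..<v}) P" "(\<Sum>(u, v)\<in>P. v - u) < min d e"
    have "(\<Sum>(u, v)\<in>P. \<bar>f v + g v - (f u + g u)\<bar>) \<le> (\<Sum>(u, v)\<in>P. \<bar>f v - f u\<bar> + \<bar>g v - g u\<bar>)"
      by (intro sum_mono) auto
    also have "\<dots> = (\<Sum>(u, v)\<in>P. \<bar>f v - f u\<bar>) + (\<Sum>(u, v)\<in>P. \<bar>g v - g u\<bar>)"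
      by (simp add: sum.distrib case_prod_beta')
    also have "\<dots> < \<epsilon>" using d(2)[OF P(1-3)] e(2)[OF P(1-3)] P(4) by linarith
    finally show "(\<Sum>(u, v)\<in>P. \<bar>f v + g v - (f u + g u)\<bar>) < \<epsilon>" .
  qed
qed

lemma abs_continuous_on_interval_continuous:
  assumes f: "abs_continuous_on_interval a b f"
  shows "continuous_on {a..b} f"
  unfolding continuous_on_iff
proof (intro ballI allI impI)
  fix x \<epsilon> :: real assume x: "x \<in> {a..b}" and \<epsilon>: "\<epsilon> > 0"
  obtain d where d: "d > 0" "\<And>P. finite P \<Longrightarrow> (\<forall>(u, v)\<in>P. a \<le> u \<and> u \<le> v \<and> v \<le> b) \<Longrightarrow>
        disjoint_family_on (\<lambda>(u, v). {u<..<v}) P \<Longrightarrow>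
        (\<Sum>(u, v)\<in>P. v - u) < d \<Longrightarrow> (\<Sum>(u, v)\<in>P. \<bar>f v - f u\<bar>) < \<epsilon>"
    using f[unfolded abs_continuous_on_interval_def, rule_format, OF \<epsilon>] by blast
  show "\<exists>d>0. \<forall>x'\<in>{a..b}. dist x' x < d \<longrightarrow> dist (f x') (f x) < \<epsilon>"
  proof (intro exI[of _ d] conjI ballI impI d(1))
    fix x' assume x': "x' \<in> {a..b}" "dist x' x < d"
    \<comment> \<open>A family consisting of a single interval, with its end points put in
      order.\<close>
    have "(\<Sum>(u, v)\<in>{(min x x', max x x')}. \<bar>f v - f u\<bar>) < \<epsilon>"
      by (rule d(2)) (use x x' in \<open>auto simp: disjoint_family_on_def dist_real_def\<close>)
    then show "dist (f x') (f x) < \<epsilon>" by (auto simp: dist_real_def min_def max_def split: if_splits)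
  qed
qed

lemma primitive_on_abs_continuous:
  assumes "primitive_on a b g h"
  shows "abs_continuous_on_interval a b h"
proof -
  have g: "continuous_on {a..b} g" and d: "\<And>t. t \<in> {a..b} \<Longrightarrow> (h has_real_derivative g t) (at t)"
    using assms by (auto simp: primitive_on_def)
  have "bounded (g ` {a..b})" using g by (intro compact_imp_bounded compact_continuous_image) auto
  then obtain B where B: "\<And>t. t \<in> {a..b} \<Longrightarrow> \<bar>g t\<bar> \<le> B" by (force simp: bounded_iff)
  show ?thesis
  proof (rule abs_continuous_on_interval_lipschitz)
    fix u v assume uv: "a \<le> u" "u \<le> v" "v \<le> b"
    have "norm (h v - h u) \<le> B * norm (v - u)"
      by (rule field_differentiable_bound[where S = "{a..b}" and f' = g])
        (use uv B d in \<open>auto intro: has_field_derivative_at_within\<close>)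
    then show "\<bar>h v - h u\<bar> \<le> B * (v - u)" using uv by simp
  qed
qed

text \<open>The Caputo derivative as an operator on the derivative g. Directions of variation come
  with a known continuous derivative, so linearity and continuity follow from the kernel without
  recourse to \<open>deriv\<close>.\<close>

definition caputo_of :: "real \<Rightarrow> real \<Rightarrow> (real \<Rightarrow> real) \<Rightarrow> real \<Rightarrow> real" where
  "caputo_of a \<alpha> g x = 1 / Gamma (1 - \<alpha>) * integral {a..x} (\<lambda>t. (x - t) powr (- \<alpha>) * g t)"

text \<open>As y is differentiable only almost everywhere, the derivatives add up off a null set,
  which neither integrability nor the integral notices.\<close>

lemma caputo_left_add_primitive:
  assumes \<alpha>: "0 < \<alpha>" "\<alpha> < 1" and x: "x \<in> {a..b}"
    and y: "caputo_left_exists a \<alpha> y x" and h: "primitive_on a b g h"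
  shows "caputo_left_exists a \<alpha> (\<lambda>t. y t + h t) x"
    and "caputo_left a \<alpha> (\<lambda>t. y t + h t) x = caputo_left a \<alpha> y x + caputo_of a \<alpha> g x"
proof -
  have g: "continuous_on {a..x} g" and d: "\<And>t. t \<in> {a..x} \<Longrightarrow> (h has_real_derivative g t) (at t)"
    using h x by (auto simp: primitive_on_def intro: continuous_on_subset)
  have ae: "AE t in lebesgue. t \<in> {a..x} \<longrightarrow> y differentiable (at t)"
    and yi: "(\<lambda>t. (x - t) powr (- \<alpha>) * deriv y t) absolutely_integrable_on {a..x}"
    using y by (auto simp: caputo_left_exists_def)
  have gi: "(\<lambda>t. (x - t) powr (- \<alpha>) * g t) absolutely_integrable_on {a..x}"
    using \<alpha> by (intro absolutely_integrable_powr_left g) auto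
  obtain N where N: "N \<in> null_sets lebesgue" "{t. \<not> (t \<in> {a..x} \<longrightarrow> y differentiable (at t))} \<subseteq> N"
    using ae by (auto simp: eventually_ae_filter)
  then have neg: "negligible N" by (simp add: negligible_iff_null_sets)
  have eq: "(x - t) powr (- \<alpha>) * deriv (\<lambda>t. y t + h t) t =
      (x - t) powr (- \<alpha>) * deriv y t + (x - t) powr (- \<alpha>) * g t" if t: "t \<in> {a..x} - N" for t
  proof -
    have "y differentiable (at t)" using t N by auto
    then have "(y has_real_derivative deriv y t) (at t)"
      by (simp add: DERIV_deriv_iff_real_differentiable)
    then have "((\<lambda>t. y t + h t) has_real_derivative deriv y t + g t) (at t)"
      using d t by (intro derivative_intros) auto
    then show ?thesis by (simp add: DERIV_imp_deriv distrib_left)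
  qed
  have "h differentiable (at t)" if "t \<in> {a..x}" for t
    using d[OF that] real_differentiable_def by blast
  then have hd: "\<forall>t\<in>{a..x}. h differentiable (at t)" by blast
  have "AE t in lebesgue. t \<in> {a..x} \<longrightarrow> (\<lambda>t. y t + h t) differentiable (at t)"
    using ae by (rule eventually_mono) (use hd in \<open>blast intro: differentiable_add\<close>)
  moreover have "(\<lambda>t. (x - t) powr (- \<alpha>) * deriv (\<lambda>t. y t + h t) t) absolutely_integrable_on {a..x}"
    by (rule absolutely_integrable_spike[OF set_integral_add(1)[OF yi gi] neg]) (rule eq)
  ultimately show "caputo_left_exists a \<alpha> (\<lambda>t. y t + h t) x"
    unfolding caputo_left_exists_def by blast
  have "integral {a..x} (\<lambda>t. (x - t) powr (- \<alpha>) * deriv (\<lambda>t. y t + h t) t) =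
      integral {a..x} (\<lambda>t. (x - t) powr (- \<alpha>) * deriv y t + (x - t) powr (- \<alpha>) * g t)"
    by (rule integral_spike[OF neg]) (use eq in auto)
  also have "\<dots> = integral {a..x} (\<lambda>t. (x - t) powr (- \<alpha>) * deriv y t) + integral {a..x} (\<lambda>t. (x - t) powr (- \<alpha>) * g t)"
    using yi gi by (intro Henstock_Kurzweil_Integration.integral_add) (auto simp: absolutely_integrable_on_def)
  finally show "caputo_left a \<alpha> (\<lambda>t. y t + h t) x = caputo_left a \<alpha> y x + caputo_of a \<alpha> g x"
    by (simp add: caputo_left_def caputo_of_def distrib_left add_divide_distrib)
qed

lemma rl_int_left_add_continuous:
  assumes \<beta>: "0 < \<beta>" and x: "x \<in> {a..b}"
    and y: "rl_int_left_exists a \<beta> y x" and h: "continuous_on {a..b} h"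
  shows "rl_int_left_exists a \<beta> (\<lambda>t. y t + h t) x"
    and "rl_int_left a \<beta> (\<lambda>t. y t + h t) x = rl_int_left a \<beta> y x + rl_int_left a \<beta> h x"
proof -
  have "continuous_on {a..x} h" using h x by (auto intro: continuous_on_subset)
  then have hi: "(\<lambda>t. (x - t) powr (\<beta> - 1) * h t) absolutely_integrable_on {a..x}"
    using \<beta> by (intro absolutely_integrable_powr_left) auto
  have yi: "(\<lambda>t. (x - t) powr (\<beta> - 1) * y t) absolutely_integrable_on {a..x}"
    using y by (simp add: rl_int_left_exists_def)
  show "rl_int_left_exists a \<beta> (\<lambda>t. y t + h t) x"
    using set_integral_add(1)[OF yi hi] by (simp add: rl_int_left_exists_def distrib_left)
  show "rl_int_left a \<beta> (\<lambda>t. y t + h t) x = rl_int_left a \<beta> y x + rl_int_left a \<beta> h x"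
    using yi hi by (simp add: rl_int_left_def distrib_left add_divide_distrib absolutely_integrable_on_def
        Henstock_Kurzweil_Integration.integral_add)
qed

lemma integral_powr_left_combine:
  fixes f g :: "real \<Rightarrow> real"
  assumes "\<kappa> > -1" "continuous_on {a..x} f" "continuous_on {a..x} g"
  shows "integral {a..x} (\<lambda>t. (x - t) powr \<kappa> * (r * f t + s * g t)) =
    r * integral {a..x} (\<lambda>t. (x - t) powr \<kappa> * f t) + s * integral {a..x} (\<lambda>t. (x - t) powr \<kappa> * g t)"
proof -
  have "((\<lambda>t. r * ((x - t) powr \<kappa> * f t) + s * ((x - t) powr \<kappa> * g t)) has_integral
     r * integral {a..x} (\<lambda>t. (x - t) powr \<kappa> * f t) + s * integral {a..x} (\<lambda>t. (x - t) powr \<kappa> * g t)) {a..x}"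
    using absolutely_integrable_powr_left[OF assms(1,2)] absolutely_integrable_powr_left[OF assms(1,3)]
    by (intro has_integral_add has_integral_mult_right) (auto simp: absolutely_integrable_on_def)
  then show ?thesis by (simp add: integral_unique algebra_simps)
qed

lemma integral_powr_right_combine:
  fixes f g :: "real \<Rightarrow> real"
  assumes "\<kappa> > -1" "continuous_on {x..b} f" "continuous_on {x..b} g"
  shows "integral {x..b} (\<lambda>t. (t - x) powr \<kappa> * (r * f t + s * g t)) =
    r * integral {x..b} (\<lambda>t. (t - x) powr \<kappa> * f t) + s * integral {x..b} (\<lambda>t. (t - x) powr \<kappa> * g t)"
proof -
  have "((\<lambda>t. r * ((t - x) powr \<kappa> * f t) + s * ((t - x) powr \<kappa> * g t)) has_integral
     r * integral {x..b} (\<lambda>t. (t - x) powr \<kappa> * f t) + s * integral {x..b} (\<lambda>t. (t - x) powr \<kappa> * g t)) {x..b}"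
    using absolutely_integrable_powr_right[OF assms(1,2)] absolutely_integrable_powr_right[OF assms(1,3)]
    by (intro has_integral_add has_integral_mult_right) (auto simp: absolutely_integrable_on_def)
  then show ?thesis by (simp add: integral_unique algebra_simps)
qed

lemma admissible_add_primitive:
  assumes \<alpha>: "0 < \<alpha>" "\<alpha> < 1" and \<beta>: "0 < \<beta>"
    and y: "y \<in> admissible_class a b \<alpha> \<beta>" and h: "primitive_on a b g h"
  shows "(\<lambda>t. y t + h t) \<in> admissible_class a b \<alpha> \<beta>"
proof -
  note hc = primitive_on_continuous[OF h]
  have g: "continuous_on {a..b} g" using h by (simp add: primitive_on_def)
  have ex: "\<forall>x\<in>{a..b}. caputo_left_exists a \<alpha> y x" "\<forall>x\<in>{a..b}. rl_int_left_exists a \<beta> y x"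
    and co: "continuous_on {a..b} (caputo_left a \<alpha> y)" "continuous_on {a..b} (rl_int_left a \<beta> y)"
    and ac: "abs_continuous_on_interval a b y"
    using y by (auto simp: admissible_class_def)
  have "continuous_on {a..b} (\<lambda>x. caputo_left a \<alpha> y x + caputo_of a \<alpha> g x)"
    unfolding caputo_of_def using \<alpha>
    by (intro continuous_intros co continuous_on_integral_powr_left g) auto
  then have 1: "continuous_on {a..b} (caputo_left a \<alpha> (\<lambda>t. y t + h t))"
    by (rule continuous_on_eq) (use caputo_left_add_primitive(2)[OF \<alpha> _ _ h] ex in auto)
  have "continuous_on {a..b} (\<lambda>x. rl_int_left a \<beta> y x + rl_int_left a \<beta> h x)"
    using \<beta> by (subst (2) rl_int_left_def, intro continuous_intros co continuous_on_integral_powr_left hc) auto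
  then have 2: "continuous_on {a..b} (rl_int_left a \<beta> (\<lambda>t. y t + h t))"
    by (rule continuous_on_eq) (use rl_int_left_add_continuous(2)[OF \<beta> _ _ hc] ex in auto)
  show ?thesis
    unfolding admissible_class_def mem_Collect_eq
    using 1 2 caputo_left_add_primitive(1)[OF \<alpha> _ _ h] rl_int_left_add_continuous(1)[OF \<beta> _ _ hc] ex
      abs_continuous_on_interval_add[OF ac primitive_on_abs_continuous[OF h]] by blast
qed

subsection \<open>The first variation\<close>

text \<open>A line through p whose direction has zero first component stays in X \<times> UNIV.
  Hence the derivative relative to this set yields an ordinary two-sided partial derivative, even
  where the first component of p is an end point of X. The hypothesis on \<phi> is pointwise so that
  the slices in \<open>d_y\<close>, \<open>l_y\<close> and the like fit it literally.\<close>

lemma deriv_slice: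
  fixes f :: "real \<times> 'e::real_normed_vector \<Rightarrow> real"
  assumes f: "(f has_derivative f') (at p within X \<times> UNIV)" and p: "p \<in> X \<times> UNIV"
    and e: "fst e = 0" and \<phi>: "\<And>s. \<phi> s = p + (s - s0) *\<^sub>R e"
  shows "deriv (\<lambda>s. f (\<phi> s)) s0 = f' e"
proof -
  have d: "(\<phi> has_derivative (\<lambda>h. h *\<^sub>R e)) (at s0)"
    unfolding \<phi>[abs_def] by (auto intro!: derivative_eq_intros)
  have "\<phi> s \<in> X \<times> UNIV" for s using p e by (simp add: \<phi> mem_Times_iff)
  then have "range \<phi> \<subseteq> X \<times> UNIV" by blast
  then have "(f has_derivative f') (at (\<phi> s0) within range \<phi>)"
    using f by (auto simp: \<phi> intro: has_derivative_subset)
  from has_derivative_in_compose[OF d this]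
  have "((\<lambda>s. f (\<phi> s)) has_derivative (\<lambda>h. f' (h *\<^sub>R e))) (at s0)" .
  then have "((\<lambda>s. f (\<phi> s)) has_real_derivative f' e) (at s0)"
    using has_derivative_bounded_linear[OF f]
    by (simp add: has_field_derivative_def bounded_linear.linear linear_cmul mult.commute[of _ "f' e"])
  then show ?thesis by (rule DERIV_imp_deriv)
qed

lemma lagrangian_derivative:
  fixes K :: lagrangian
  assumes K: "(K has_derivative K') (at p within X \<times> UNIV)" and p: "p \<in> X \<times> UNIV"
  shows "d_y K p = K' (0, 1, 0, 0, 0)" "d_v K p = K' (0, 0, 1, 0, 0)"
    "d_w K p = K' (0, 0, 0, 1, 0)" "d_z K p = K' (0, 0, 0, 0, 1)"
    "K' (0, h, k, m, n) = d_y K p * h + d_v K p * k + d_w K p * m + d_z K p * n"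
proof -
  obtain x y v w z where p': "p = (x, y, v, w, z)" by (cases p)
  note sl = deriv_slice[OF K p]
  show y: "d_y K p = K' (0, 1, 0, 0, 0)"
    using sl[of "(0, 1, 0, 0, 0)" "\<lambda>s. (x, s, v, w, z)" y] by (simp add: p' d_y_def)
  show v: "d_v K p = K' (0, 0, 1, 0, 0)"
    using sl[of "(0, 0, 1, 0, 0)" "\<lambda>s. (x, y, s, w, z)" v] by (simp add: p' d_v_def)
  show w: "d_w K p = K' (0, 0, 0, 1, 0)"
    using sl[of "(0, 0, 0, 1, 0)" "\<lambda>s. (x, y, v, s, z)" w] by (simp add: p' d_w_def)
  show z: "d_z K p = K' (0, 0, 0, 0, 1)"
    using sl[of "(0, 0, 0, 0, 1)" "\<lambda>s. (x, y, v, w, s)" z] by (simp add: p' d_z_def)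
  interpret bounded_linear K' by (rule has_derivative_bounded_linear[OF K])
  have "(0, h, k, m, n) = h *\<^sub>R (0, 1, 0, 0, 0) + k *\<^sub>R (0, 0, 1, 0, 0) + m *\<^sub>R (0, 0, 0, 1, 0)
      + n *\<^sub>R (0::real, 0::real, 0::real, 0::real, 1::real)" by simp
  then have "K' (0, h, k, m, n) = h * K' (0, 1, 0, 0, 0) + k * K' (0, 0, 1, 0, 0) + m * K' (0, 0, 0, 1, 0)
      + n * K' (0, 0, 0, 0, 1)" by (simp only: add scaleR real_scaleR_def)
  then show "K' (0, h, k, m, n) = d_y K p * h + d_v K p * k + d_w K p * m + d_z K p * n"
    by (simp add: y v w z mult.commute)
qed

lemma integrand_derivative:
  fixes l :: integrand
  assumes l: "(l has_derivative l') (at p within X \<times> UNIV)" and p: "p \<in> X \<times> UNIV"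
  shows "l_y l p = l' (0, 1, 0, 0)" "l_v l p = l' (0, 0, 1, 0)" "l_w l p = l' (0, 0, 0, 1)"
    "l' (0, h, k, m) = l_y l p * h + l_v l p * k + l_w l p * m"
proof -
  obtain x y v w where p': "p = (x, y, v, w)" by (cases p)
  note sl = deriv_slice[OF l p]
  show y: "l_y l p = l' (0, 1, 0, 0)"
    using sl[of "(0, 1, 0, 0)" "\<lambda>s. (x, s, v, w)" y] by (simp add: p' l_y_def)
  show v: "l_v l p = l' (0, 0, 1, 0)"
    using sl[of "(0, 0, 1, 0)" "\<lambda>s. (x, y, s, w)" v] by (simp add: p' l_v_def)
  show w: "l_w l p = l' (0, 0, 0, 1)"
    using sl[of "(0, 0, 0, 1)" "\<lambda>s. (x, y, v, s)" w] by (simp add: p' l_w_def)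
  interpret bounded_linear l' by (rule has_derivative_bounded_linear[OF l])
  have "(0, h, k, m) = h *\<^sub>R (0, 1, 0, 0) + k *\<^sub>R (0, 0, 1, 0)
      + m *\<^sub>R (0::real, 0::real, 0::real, 1::real)" by simp
  then have "l' (0, h, k, m) = h * l' (0, 1, 0, 0) + k * l' (0, 0, 1, 0) + m * l' (0, 0, 0, 1)"
    by (simp only: add scaleR real_scaleR_def)
  then show "l' (0, h, k, m) = l_y l p * h + l_v l p * k + l_w l p * m"
    by (simp add: y v w mult.commute)
qed

lemma C1_onE:
  assumes "C1_on S f"
  obtains f' where "\<And>p. p \<in> S \<Longrightarrow> (f has_derivative blinfun_apply (f' p)) (at p within S)"
    "continuous_on S f'"
  using assms unfolding C1_on_def by blast

lemma C1_on_imp_continuous_on: "C1_on S f \<Longrightarrow> continuous_on S f"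
  unfolding C1_on_def by (meson continuous_on_eq_continuous_within has_derivative_continuous)

lemma continuous_on_lagrangian_partials:
  fixes K :: lagrangian
  assumes K: "C1_on (X \<times> UNIV) K"
  shows "continuous_on (X \<times> UNIV) (d_y K)" "continuous_on (X \<times> UNIV) (d_v K)"
    "continuous_on (X \<times> UNIV) (d_w K)" "continuous_on (X \<times> UNIV) (d_z K)"
proof -
  obtain K' where K': "\<And>p. p \<in> X \<times> UNIV \<Longrightarrow> (K has_derivative blinfun_apply (K' p)) (at p within X \<times> UNIV)"
    "continuous_on (X \<times> UNIV) K'" using C1_onE[OF K] by blast
  have c: "continuous_on (X \<times> UNIV) (\<lambda>p. blinfun_apply (K' p) e)" for e
    by (intro continuous_intros K'(2))
  show "continuous_on (X \<times> UNIV) (d_y K)"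
    by (rule continuous_on_eq[OF c]) (rule lagrangian_derivative[OF K'(1), symmetric])
  show "continuous_on (X \<times> UNIV) (d_v K)"
    by (rule continuous_on_eq[OF c]) (rule lagrangian_derivative[OF K'(1), symmetric])
  show "continuous_on (X \<times> UNIV) (d_w K)"
    by (rule continuous_on_eq[OF c]) (rule lagrangian_derivative[OF K'(1), symmetric])
  show "continuous_on (X \<times> UNIV) (d_z K)"
    by (rule continuous_on_eq[OF c]) (rule lagrangian_derivative[OF K'(1), symmetric])
qed

lemma continuous_on_integrand_partials:
  fixes l :: integrand
  assumes l: "C1_on (X \<times> UNIV) l"
  shows "continuous_on (X \<times> UNIV) (l_y l)" "continuous_on (X \<times> UNIV) (l_v l)"
    "continuous_on (X \<times> UNIV) (l_w l)"
proof -
  obtain l' where l': "\<And>p. p \<in> X \<times> UNIV \<Longrightarrow> (l has_derivative blinfun_apply (l' p)) (at p within X \<times> UNIV)"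
    "continuous_on (X \<times> UNIV) l'" using C1_onE[OF l] by blast
  have c: "continuous_on (X \<times> UNIV) (\<lambda>p. blinfun_apply (l' p) e)" for e
    by (intro continuous_intros l'(2))
  show "continuous_on (X \<times> UNIV) (l_y l)"
    by (rule continuous_on_eq[OF c]) (rule integrand_derivative[OF l'(1), symmetric])
  show "continuous_on (X \<times> UNIV) (l_v l)"
    by (rule continuous_on_eq[OF c]) (rule integrand_derivative[OF l'(1), symmetric])
  show "continuous_on (X \<times> UNIV) (l_w l)"
    by (rule continuous_on_eq[OF c]) (rule integrand_derivative[OF l'(1), symmetric])
qed

lemma continuous_on_integral_tail:
  assumes "continuous_on {a..b::real} f"
  shows "continuous_on {a..b} (\<lambda>x. integral {x..b} (f :: real \<Rightarrow> real))"
  unfolding continuous_on_eq_continuous_within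
  by (intro ballI DERIV_continuous[OF integral_has_real_derivative'[OF assms]])

text \<open>The tail integral is an antiderivative of - f. Both boundary terms vanish, since the
  tail is zero at b and \<open>Z\<close> is zero at a.\<close>

lemma integral_tail_by_parts:
  fixes f z Z :: "real \<Rightarrow> real"
  assumes ab: "a \<le> b" and f: "continuous_on {a..b} f" and Z: "continuous_on {a..b} Z"
    and d: "\<And>x. x \<in> {a<..<b} \<Longrightarrow> (Z has_real_derivative z x) (at x)" and Za: "Z a = 0"
  shows "integral {a..b} (\<lambda>x. f x * Z x) = integral {a..b} (\<lambda>x. z x * integral {x..b} f)"
proof -
  have "((\<lambda>x. z x * integral {x..b} f) has_integral integral {a..b} (\<lambda>x. f x * Z x)) {a..b}"
  proof (rule integration_by_parts_interior[where prod = "(*)" and f = Z and f' = z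
        and g = "\<lambda>x. integral {x..b} f" and g' = "\<lambda>x. - f x"])
    show "((\<lambda>x. integral {x..b} f) has_vector_derivative - f x) (at x)" if "x \<in> {a<..<b}" for x
    proof -
      have "((\<lambda>x. integral {x..b} f) has_real_derivative - f x) (at x within {a..b})"
        using that by (intro integral_has_real_derivative' f) auto
      moreover have "at x within {a..b} = at x" using that by (intro at_within_interior) simp
      ultimately show ?thesis by (simp add: has_real_derivative_iff_has_vector_derivative)
    qed
    have "((\<lambda>x. f x * Z x) has_integral integral {a..b} (\<lambda>x. f x * Z x)) {a..b}"
      by (intro integrable_integral integrable_continuous_real continuous_intros f Z)
    from has_integral_neg[OF this]
    show "((\<lambda>x. Z x * - f x) has_integral Z b * integral {b..b} f - Z a * integral {a..b} f -
        integral {a..b} (\<lambda>x. f x * Z x)) {a..b}"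
      by (simp add: Za mult.commute)
  qed (use ab Z d continuous_on_integral_tail[OF f] bounded_bilinear_mult in
      \<open>auto simp: has_real_derivative_iff_has_vector_derivative\<close>)
  then show ?thesis by (simp add: integral_unique)
qed

text \<open>The increment of \<open>jet\<close> when h is added to the curve. The derivative g is a
  separate argument because the Caputo component depends on it alone.\<close>

definition variation :: "real \<Rightarrow> real \<Rightarrow> real \<Rightarrow> (real \<Rightarrow> real) \<Rightarrow> (real \<Rightarrow> real) \<Rightarrow> real \<Rightarrow>
    real \<times> real \<times> real \<times> real" where
  "variation a \<alpha> \<beta> g h x = (0, h x, caputo_of a \<alpha> g x, rl_int_left a \<beta> h x)"

text \<open>Neither a Lagrangian nor minimality is fixed, so that the results can be used for
  several Lagrangians and also for the perturbed curves.\<close>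

locale fractional_curve =
  fixes a b \<alpha> \<beta> :: real and l :: integrand and y :: "real \<Rightarrow> real"
  assumes ab: "a < b" and \<alpha>: "0 < \<alpha>" "\<alpha> < 1" and \<beta>: "0 < \<beta>"
    and l: "C1_on ({a..b} \<times> UNIV) l" and y: "y \<in> admissible_class a b \<alpha> \<beta>"
begin

abbreviation "jy \<equiv> jet a \<alpha> \<beta> y"
abbreviation "jz \<equiv> jet_z a \<alpha> \<beta> l y"
abbreviation "tail K \<equiv> tail_dz a b \<alpha> \<beta> l K y"

section \<open>Jets along a curve and along its perturbations\<close>

lemma jet_add_primitive:
  assumes h: "primitive_on a b g h" and x: "x \<in> {a..b}"
  shows "jet a \<alpha> \<beta> (\<lambda>t. y t + h t) x = jy x + variation a \<alpha> \<beta> g h x"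
  using y x caputo_left_add_primitive(2)[OF \<alpha> x _ h] rl_int_left_add_continuous(2)[OF \<beta> x _ primitive_on_continuous[OF h]]
  by (auto simp: jet_def variation_def admissible_class_def)

lemma variation_combine:
  assumes "primitive_on a b g h" "primitive_on a b k m" and x: "x \<in> {a..b}"
  shows "variation a \<alpha> \<beta> (\<lambda>t. r * g t + s * k t) (\<lambda>t. r * h t + s * m t) x =
    r *\<^sub>R variation a \<alpha> \<beta> g h x + s *\<^sub>R variation a \<alpha> \<beta> k m x"
proof -
  have "continuous_on {a..x} g" "continuous_on {a..x} k" "continuous_on {a..x} h" "continuous_on {a..x} m"
    using assms primitive_on_continuous[OF assms(1)] primitive_on_continuous[OF assms(2)]
    by (auto simp: primitive_on_def elim!: continuous_on_subset)
  then show ?thesis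
    using \<alpha> \<beta> integral_powr_left_combine[of "- \<alpha>" a x g k r s] integral_powr_left_combine[of "\<beta> - 1" a x h m r s]
    by (simp add: variation_def caputo_of_def rl_int_left_def add_divide_distrib)
qed

lemma continuous_on_variation:
  assumes h: "primitive_on a b g h"
  shows "continuous_on {a..b} (caputo_of a \<alpha> g)" "continuous_on {a..b} (rl_int_left a \<beta> h)"
    "continuous_on {a..b} (variation a \<alpha> \<beta> g h)"
proof -
  have g: "continuous_on {a..b} g" using h by (simp add: primitive_on_def)
  note hc = primitive_on_continuous[OF h]
  show 1: "continuous_on {a..b} (caputo_of a \<alpha> g)"
    unfolding caputo_of_def[abs_def] using \<alpha> by (intro continuous_intros continuous_on_integral_powr_left g) auto
  show 2: "continuous_on {a..b} (rl_int_left a \<beta> h)"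
    unfolding rl_int_left_def[abs_def] using \<beta> by (intro continuous_intros continuous_on_integral_powr_left hc) auto
  show "continuous_on {a..b} (variation a \<alpha> \<beta> g h)"
    unfolding variation_def[abs_def] by (intro continuous_intros hc 1 2)
qed

lemma continuous_on_jet: "continuous_on {a..b} jy"
proof -
  have "continuous_on {a..b} y" "continuous_on {a..b} (caputo_left a \<alpha> y)" "continuous_on {a..b} (rl_int_left a \<beta> y)"
    using y abs_continuous_on_interval_continuous by (auto simp: admissible_class_def)
  then show ?thesis unfolding jet_def[abs_def] by (intro continuous_intros)
qed

lemma jet_mem: "x \<in> {a..b} \<Longrightarrow> jy x \<in> {a..b} \<times> UNIV"
  by (simp add: jet_def)

lemma jet_z_mem: "x \<in> {a..b} \<Longrightarrow> jz x \<in> {a..b} \<times> UNIV"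
  by (simp add: jet_z_def)

lemma jet_z_eq: "jet_z a \<alpha> \<beta> l u x = with_z (jet a \<alpha> \<beta> u x) (integral {a..x} (\<lambda>t. l (jet a \<alpha> \<beta> u t)))"
  by (simp add: jet_z_def jet_def with_z_def indef_def)

lemma continuous_on_along_jet:
  assumes "continuous_on ({a..b} \<times> UNIV) f"
  shows "continuous_on {a..b} (\<lambda>x. f (jy x))"
  by (rule continuous_on_compose2[OF assms continuous_on_jet]) (use jet_mem in blast)

lemma continuous_on_jet_z: "continuous_on {a..b} jz"
proof -
  have "continuous_on {a..b} (\<lambda>x. integral {a..x} (\<lambda>t. l (jy t)))"
    by (intro indefinite_integral_continuous_1 integrable_continuous_real continuous_on_along_jet
        C1_on_imp_continuous_on l)
  then show ?thesis
    unfolding jet_z_eq[abs_def] with_z_def by (intro continuous_intros continuous_on_jet)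
qed

lemma continuous_on_along_jet_z:
  assumes "continuous_on ({a..b} \<times> UNIV) f"
  shows "continuous_on {a..b} (\<lambda>x. f (jz x))"
  by (rule continuous_on_compose2[OF assms continuous_on_jet_z]) (use jet_z_mem in blast)

lemma continuous_on_l_partials:
  "continuous_on {a..b} (\<lambda>x. l_y l (jy x))" "continuous_on {a..b} (\<lambda>x. l_v l (jy x))"
  "continuous_on {a..b} (\<lambda>x. l_w l (jy x))"
  by (intro continuous_on_along_jet continuous_on_integrand_partials l)+

lemma continuous_on_K_partials:
  assumes K: "C1_on ({a..b} \<times> UNIV) K"
  shows "continuous_on {a..b} (\<lambda>x. d_y K (jz x))" "continuous_on {a..b} (\<lambda>x. d_v K (jz x))"
    "continuous_on {a..b} (\<lambda>x. d_w K (jz x))" "continuous_on {a..b} (\<lambda>x. d_z K (jz x))"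
    "continuous_on {a..b} (tail K)"
proof -
  show "continuous_on {a..b} (\<lambda>x. d_y K (jz x))" "continuous_on {a..b} (\<lambda>x. d_v K (jz x))"
    "continuous_on {a..b} (\<lambda>x. d_w K (jz x))" and z: "continuous_on {a..b} (\<lambda>x. d_z K (jz x))"
    by (intro continuous_on_along_jet_z continuous_on_lagrangian_partials K)+
  show "continuous_on {a..b} (tail K)"
    unfolding tail_dz_def[abs_def] by (rule continuous_on_integral_tail[OF z])
qed

text \<open>When the z component of a variation has been eliminated, every partial derivative of K
  is accompanied by \<open>tail K\<close> times the corresponding partial derivative of l. Then
  \<open>stress\<close> multiplies the Caputo derivative of the variation, \<open>load\<close> its
  fractional integral, and \<open>force\<close> the variation itself once the fractional integral
  has been shifted onto \<open>load\<close>.\<close>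

definition stress :: "lagrangian \<Rightarrow> real \<Rightarrow> real" where
  "stress K t = d_v K (jz t) + tail K t * l_v l (jy t)"

definition load :: "lagrangian \<Rightarrow> real \<Rightarrow> real" where
  "load K t = d_w K (jz t) + tail K t * l_w l (jy t)"

definition force :: "lagrangian \<Rightarrow> real \<Rightarrow> real" where
  "force K t = d_y K (jz t) + tail K t * l_y l (jy t) + rl_int_right b \<beta> (load K) t"

text \<open>The second summand is the right fractional integral of order 1 - \<alpha> of
  \<open>stress\<close>. Formally, the derivative of \<open>momentum\<close> is minus
  \<open>EL_lhs\<close>.\<close>

definition momentum :: "lagrangian \<Rightarrow> real \<Rightarrow> real" where
  "momentum K t = integral {t..b} (force K) +
     1 / Gamma (1 - \<alpha>) * integral {t..b} (\<lambda>s. (s - t) powr (- \<alpha>) * stress K s)"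

lemma continuous_on_momentum:
  assumes K: "C1_on ({a..b} \<times> UNIV) K"
  shows "continuous_on {a..b} (stress K)" "continuous_on {a..b} (load K)"
    "continuous_on {a..b} (force K)" "continuous_on {a..b} (momentum K)"
proof -
  note c = continuous_on_K_partials[OF K] continuous_on_l_partials
  show 1: "continuous_on {a..b} (stress K)" and 2: "continuous_on {a..b} (load K)"
    unfolding stress_def[abs_def] load_def[abs_def] by (intro continuous_intros c)+
  show 3: "continuous_on {a..b} (force K)"
    unfolding force_def[abs_def] rl_int_right_def using \<beta>
    by (intro continuous_intros c continuous_on_integral_powr_right 2) auto
  show "continuous_on {a..b} (momentum K)"
    unfolding momentum_def[abs_def] using \<alpha>
    by (intro continuous_intros continuous_on_integral_tail continuous_on_integral_powr_right 1 3) auto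
qed

text \<open>Every component of the variation is traced back to g = h': the z component and h itself
  by ordinary integration by parts, the fractional components by \<open>integral_powr_swap\<close>.
  The condition at a removes the boundary term of h; at b the tail of \<open>force\<close>
  vanishes.\<close>

lemma first_variation:
  assumes K: "C1_on ({a..b} \<times> UNIV) K" and h: "primitive_on a b g h" and ha: "h a = 0"
    and l': "\<And>p. p \<in> {a..b} \<times> UNIV \<Longrightarrow> (l has_derivative blinfun_apply (l' p)) (at p within {a..b} \<times> UNIV)"
    and K': "\<And>p. p \<in> {a..b} \<times> UNIV \<Longrightarrow> (K has_derivative blinfun_apply (K' p)) (at p within {a..b} \<times> UNIV)"
  shows "integral {a..b} (\<lambda>x. K' (jz x) (with_z (variation a \<alpha> \<beta> g h x)
           (integral {a..x} (\<lambda>t. l' (jy t) (variation a \<alpha> \<beta> g h t))))) =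
         integral {a..b} (\<lambda>t. g t * momentum K t)"
proof -
  define c where "c = caputo_of a \<alpha> g"
  define w where "w = rl_int_left a \<beta> h"
  \<comment> \<open>The first-order change of the integrand of \<open>indef\<close>; its integral
    \<open>Z\<close> is the z component of the variation.\<close>
  define z where "z t = l_y l (jy t) * h t + l_v l (jy t) * c t + l_w l (jy t) * w t" for t
  define Z where "Z x = integral {a..x} z" for x
  have g: "continuous_on {a..b} g" and hd: "\<And>t. t \<in> {a..b} \<Longrightarrow> (h has_real_derivative g t) (at t)"
    using h by (auto simp: primitive_on_def)
  note hc = primitive_on_continuous[OF h]
  have cc: "continuous_on {a..b} c" and wc: "continuous_on {a..b} w"
    using continuous_on_variation[OF h] by (simp_all add: c_def w_def)
  note Kc = continuous_on_K_partials[OF K] and lc = continuous_on_l_partials and Mc = continuous_on_momentum[OF K]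
  have zc: "continuous_on {a..b} z" unfolding z_def by (intro continuous_intros lc hc cc wc)
  have Zc: "continuous_on {a..b} Z"
    unfolding Z_def by (intro indefinite_integral_continuous_1 integrable_continuous_real zc)
  have Zd: "(Z has_real_derivative z x) (at x)" if "x \<in> {a<..<b}" for x
  proof -
    have "(Z has_real_derivative z x) (at x within {a..b})"
      unfolding Z_def using that by (intro integral_has_real_derivative zc) auto
    moreover have "at x within {a..b} = at x" using that by (intro at_within_interior) simp
    ultimately show ?thesis by simp
  qed
  have i1: "(\<lambda>x. (d_y K (jz x) + tail K x * l_y l (jy x)) * h x) integrable_on {a..b}"
    and i2: "(\<lambda>x. stress K x * c x) integrable_on {a..b}"
    and i3: "(\<lambda>x. load K x * w x) integrable_on {a..b}"
    by (intro integrable_continuous_real continuous_intros Kc lc hc cc wc Mc)+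
  have var: "variation a \<alpha> \<beta> g h t = (0, h t, c t, w t)" for t
    by (simp add: variation_def c_def w_def)
  have zeq: "l' (jy t) (variation a \<alpha> \<beta> g h t) = z t" if "t \<in> {a..b}" for t
    using integrand_derivative(4)[OF l'[OF jet_mem[OF that]] jet_mem[OF that]] by (simp add: var z_def)
  have "integral {a..x} (\<lambda>t. l' (jy t) (variation a \<alpha> \<beta> g h t)) = Z x" if "x \<in> {a..b}" for x
    unfolding Z_def by (rule integral_cong) (use that zeq in auto)
  then have "integral {a..b} (\<lambda>x. K' (jz x) (with_z (variation a \<alpha> \<beta> g h x)
           (integral {a..x} (\<lambda>t. l' (jy t) (variation a \<alpha> \<beta> g h t))))) =
      integral {a..b} (\<lambda>x. d_y K (jz x) * h x + d_v K (jz x) * c x + d_w K (jz x) * w x + d_z K (jz x) * Z x)"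
    using lagrangian_derivative(5)[OF K'[OF jet_z_mem] jet_z_mem]
    by (intro integral_cong) (simp add: var with_z_def)
  also have "\<dots> = integral {a..b} (\<lambda>x. d_y K (jz x) * h x + d_v K (jz x) * c x + d_w K (jz x) * w x) +
      integral {a..b} (\<lambda>x. d_z K (jz x) * Z x)"
    by (intro Henstock_Kurzweil_Integration.integral_add integrable_continuous_real continuous_intros Kc hc cc wc Zc)
  \<comment> \<open>Elimination of the z component: this is the origin of \<open>tail K\<close> in
    the Euler--Lagrange equation.\<close>
  also have "integral {a..b} (\<lambda>x. d_z K (jz x) * Z x) = integral {a..b} (\<lambda>x. z x * tail K x)"
    unfolding tail_dz_def using ab by (intro integral_tail_by_parts Kc Zc Zd) (auto simp: Z_def)
  also have "integral {a..b} (\<lambda>x. d_y K (jz x) * h x + d_v K (jz x) * c x + d_w K (jz x) * w x) + \<dots> =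
      integral {a..b} (\<lambda>x. (d_y K (jz x) * h x + d_v K (jz x) * c x + d_w K (jz x) * w x) + z x * tail K x)"
    by (intro Henstock_Kurzweil_Integration.integral_add[symmetric] integrable_continuous_real continuous_intros Kc hc cc wc zc)
  also have "\<dots> = integral {a..b} (\<lambda>x. (d_y K (jz x) + tail K x * l_y l (jy x)) * h x + stress K x * c x + load K x * w x)"
    by (intro integral_cong) (simp add: z_def stress_def load_def algebra_simps)
  also have "\<dots> = integral {a..b} (\<lambda>x. (d_y K (jz x) + tail K x * l_y l (jy x)) * h x) +
      integral {a..b} (\<lambda>x. stress K x * c x) + integral {a..b} (\<lambda>x. load K x * w x)"
    by (simp only: Henstock_Kurzweil_Integration.integral_add[OF integrable_add[OF i1 i2] i3]
        Henstock_Kurzweil_Integration.integral_add[OF i1 i2])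
  \<comment> \<open>The left fractional integral of h becomes the right fractional integral of
    \<open>load\<close>.\<close>
  also have "integral {a..b} (\<lambda>x. load K x * w x) = integral {a..b} (\<lambda>t. h t * rl_int_right b \<beta> (load K) t)"
  proof -
    have "integral {a..b} (\<lambda>x. load K x * w x) =
        1 / Gamma \<beta> * integral {a..b} (\<lambda>x. load K x * integral {a..x} (\<lambda>t. (x - t) powr (\<beta> - 1) * h t))"
      unfolding w_def rl_int_left_def by (subst integral_mult_right[symmetric]) (simp add: algebra_simps)
    also have "\<dots> = 1 / Gamma \<beta> * integral {a..b} (\<lambda>t. h t * integral {t..b} (\<lambda>x. (x - t) powr (\<beta> - 1) * load K x))"
      using \<beta> by (subst integral_powr_swap[OF _ Mc(2) hc]) auto
    also have "\<dots> = integral {a..b} (\<lambda>t. h t * rl_int_right b \<beta> (load K) t)"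
      unfolding rl_int_right_def by (subst integral_mult_right[symmetric]) (simp add: algebra_simps)
    finally show ?thesis .
  qed
  \<comment> \<open>The Caputo derivative is a kernel integral of g, so the swap leaves the factor g
    and produces no boundary term.\<close>
  also have "integral {a..b} (\<lambda>x. stress K x * c x) =
      integral {a..b} (\<lambda>t. g t * (1 / Gamma (1 - \<alpha>) * integral {t..b} (\<lambda>s. (s - t) powr (- \<alpha>) * stress K s)))"
  proof -
    have "integral {a..b} (\<lambda>x. stress K x * c x) =
        1 / Gamma (1 - \<alpha>) * integral {a..b} (\<lambda>x. stress K x * integral {a..x} (\<lambda>t. (x - t) powr (- \<alpha>) * g t))"
      unfolding c_def caputo_of_def by (subst integral_mult_right[symmetric]) (simp add: algebra_simps)
    also have "\<dots> = 1 / Gamma (1 - \<alpha>) * integral {a..b} (\<lambda>t. g t * integral {t..b} (\<lambda>x. (x - t) powr (- \<alpha>) * stress K x))"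
      using \<alpha> by (subst integral_powr_swap[OF _ Mc(1) g]) auto
    also have "\<dots> = integral {a..b} (\<lambda>t. g t * (1 / Gamma (1 - \<alpha>) * integral {t..b} (\<lambda>s. (s - t) powr (- \<alpha>) * stress K s)))"
      by (subst integral_mult_right[symmetric]) (simp add: algebra_simps)
    finally show ?thesis .
  qed
  finally have eq: "integral {a..b} (\<lambda>x. K' (jz x) (with_z (variation a \<alpha> \<beta> g h x)
           (integral {a..x} (\<lambda>t. l' (jy t) (variation a \<alpha> \<beta> g h t))))) =
      integral {a..b} (\<lambda>x. (d_y K (jz x) + tail K x * l_y l (jy x)) * h x) +
      integral {a..b} (\<lambda>t. g t * (1 / Gamma (1 - \<alpha>) * integral {t..b} (\<lambda>s. (s - t) powr (- \<alpha>) * stress K s))) +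
      integral {a..b} (\<lambda>t. h t * rl_int_right b \<beta> (load K) t)" .
  have Rc: "continuous_on {a..b} (rl_int_right b \<beta> (load K))"
    unfolding rl_int_right_def[abs_def] using \<beta>
    by (intro continuous_intros continuous_on_integral_powr_right Mc) auto
  \<comment> \<open>The two terms that still contain h combine to \<open>force\<close>; one more
    integration by parts replaces h by g.\<close>
  have "integral {a..b} (\<lambda>x. (d_y K (jz x) + tail K x * l_y l (jy x)) * h x) +
      integral {a..b} (\<lambda>t. h t * rl_int_right b \<beta> (load K) t) =
      integral {a..b} (\<lambda>x. (d_y K (jz x) + tail K x * l_y l (jy x)) * h x + h x * rl_int_right b \<beta> (load K) x)"
    by (intro Henstock_Kurzweil_Integration.integral_add[symmetric] integrable_continuous_real continuous_intros Kc lc hc Rc)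
  also have "\<dots> = integral {a..b} (\<lambda>x. force K x * h x)"
    by (intro integral_cong) (simp add: force_def algebra_simps)
  also have "\<dots> = integral {a..b} (\<lambda>x. g x * integral {x..b} (force K))"
    using ab by (intro integral_tail_by_parts Mc hc hd ha) auto
  finally have "integral {a..b} (\<lambda>x. (d_y K (jz x) + tail K x * l_y l (jy x)) * h x) +
      integral {a..b} (\<lambda>t. h t * rl_int_right b \<beta> (load K) t) = integral {a..b} (\<lambda>x. g x * integral {x..b} (force K))" .
  moreover have "integral {a..b} (\<lambda>t. g t * momentum K t) = integral {a..b} (\<lambda>x. g x * integral {x..b} (force K)) +
      integral {a..b} (\<lambda>t. g t * (1 / Gamma (1 - \<alpha>) * integral {t..b} (\<lambda>s. (s - t) powr (- \<alpha>) * stress K s)))"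
    unfolding momentum_def distrib_left using \<alpha>
    by (intro Henstock_Kurzweil_Integration.integral_add integrable_continuous_real continuous_intros g
        continuous_on_integral_tail continuous_on_integral_powr_right Mc) auto
  ultimately show ?thesis unfolding eq by simp
qed

end

subsection \<open>The multiplier\<close>

text \<open>Differentiability at the single point \<open>0\<close> suffices: the intermediate value theorem finds points
  of the level set of \<open>\<psi>\<close> in place of the implicit function theorem.\<close>

lemma two_param_multiplier:
  fixes \<phi> \<psi> :: "real \<times> real \<Rightarrow> real"
  assumes cont: "continuous_on UNIV \<psi>"
    and d\<psi>: "(\<psi> has_derivative (\<lambda>c. \<mu> * fst c + \<sigma> * snd c)) (at 0)" and \<mu>: "\<mu> > 0"
    and d\<phi>: "(\<phi> has_derivative (\<lambda>c. \<nu> * snd c)) (at 0)"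
    and min: "\<And>c. \<psi> c = \<psi> 0 \<Longrightarrow> \<phi> 0 \<le> \<phi> c"
  shows "\<nu> = 0"
proof (rule ccontr)
  assume \<nu>: "\<nu> \<noteq> 0"
  \<comment> \<open>\<open>C\<close> is chosen so that the points \<open>p s\<close> below have norm
    at most C * r, and \<open>e\<close> so that the linearization errors at such points are at most
    half of \<mu> * r and of \<bar>\<nu>\<bar> * r.\<close>
  define C where "C = \<bar>\<sigma>\<bar> / \<mu> + 2"
  have C: "C > 0" using divide_nonneg_pos[of "\<bar>\<sigma>\<bar>" \<mu>] \<mu> unfolding C_def by linarith
  define e where "e = min \<mu> \<bar>\<nu>\<bar> / (2 * C)"
  have e: "e > 0" using \<mu> \<nu> C by (simp add: e_def)
  obtain d1 where d1: "d1 > 0" "\<And>c. norm c < d1 \<Longrightarrow> \<bar>\<psi> c - \<psi> 0 - (\<mu> * fst c + \<sigma> * snd c)\<bar> \<le> e * norm c"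
    using d\<psi>[unfolded has_derivative_at_alt, THEN conjunct2, rule_format, OF e] by auto
  obtain d2 where d2: "d2 > 0" "\<And>c. norm c < d2 \<Longrightarrow> \<bar>\<phi> c - \<phi> 0 - \<nu> * snd c\<bar> \<le> e * norm c"
    using d\<phi>[unfolded has_derivative_at_alt, THEN conjunct2, rule_format, OF e] by auto
  define r where "r = min d1 d2 / (2 * C)"
  have r: "r > 0" using d1 d2 C by (simp add: r_def)
  have "C * r = min d1 d2 / 2" using C by (simp add: r_def)
  then have Cr: "C * r < d1" "C * r < d2" using d1(1) d2(1) by linarith+
  \<comment> \<open>The sign makes the linear part of \<phi> negative, which is to contradict
    minimality.\<close>
  define \<tau> where "\<tau> = - sgn \<nu> * r"
  have \<tau>: "\<bar>\<tau>\<bar> = r" "\<nu> * \<tau> = - \<bar>\<nu>\<bar> * r" using \<nu> r by (auto simp: \<tau>_def sgn_if abs_mult)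
  \<comment> \<open>The shift in the first coordinate cancels the contribution of \<tau> to the
    linear part of \<psi>, which becomes \<mu> * s, while the linear part of \<phi> is constant
    along this segment.\<close>
  define p where "p s = (s - \<sigma> * \<tau> / \<mu>, \<tau>)" for s
  have np: "norm (p s) \<le> C * r" if "\<bar>s\<bar> \<le> r" for s
  proof -
    have "norm (p s) \<le> \<bar>s - \<sigma> * \<tau> / \<mu>\<bar> + \<bar>\<tau>\<bar>"
      unfolding p_def using norm_Pair_le[of "s - \<sigma> * \<tau> / \<mu>" \<tau>] by simp
    also have "\<bar>s - \<sigma> * \<tau> / \<mu>\<bar> \<le> r + \<bar>\<sigma>\<bar> / \<mu> * r"
    proof -
      have "\<bar>\<sigma> * \<tau> / \<mu>\<bar> = \<bar>\<sigma>\<bar> / \<mu> * r" using \<mu> \<tau> by (simp add: abs_mult)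
      then show ?thesis using that by linarith
    qed
    finally show ?thesis using \<tau> by (simp add: C_def algebra_simps)
  qed
  have dp: "\<mu> * fst (p s) + \<sigma> * snd (p s) = \<mu> * s" for s using \<mu> by (simp add: p_def field_simps)
  have eC: "e * (C * r) \<le> \<mu> * r / 2" "e * (C * r) \<le> \<bar>\<nu>\<bar> * r / 2"
  proof -
    have eq: "e * (C * r) = min \<mu> \<bar>\<nu>\<bar> * r / 2" using C by (simp add: e_def)
    show "e * (C * r) \<le> \<mu> * r / 2" "e * (C * r) \<le> \<bar>\<nu>\<bar> * r / 2"
      unfolding eq using r by (intro divide_right_mono mult_right_mono; simp)+
  qed
  have est: "\<bar>\<psi> (p s) - \<psi> 0 - \<mu> * s\<bar> \<le> \<mu> * r / 2" "\<bar>\<phi> (p s) - \<phi> 0 - \<nu> * \<tau>\<bar> \<le> \<bar>\<nu>\<bar> * r / 2"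
    if "\<bar>s\<bar> \<le> r" for s
  proof -
    have le: "e * norm (p s) \<le> e * (C * r)" using np[OF that] e by (intro mult_left_mono) auto
    show "\<bar>\<psi> (p s) - \<psi> 0 - \<mu> * s\<bar> \<le> \<mu> * r / 2"
      using d1(2)[of "p s"] np[OF that] Cr le eC dp[of s] by linarith
    have "snd (p s) = \<tau>" by (simp add: p_def)
    then show "\<bar>\<phi> (p s) - \<phi> 0 - \<nu> * \<tau>\<bar> \<le> \<bar>\<nu>\<bar> * r / 2"
      using d2(2)[of "p s"] np[OF that] Cr le eC by simp
  qed
  have \<mu>r: "\<mu> * r > 0" using \<mu> r by simp
  \<comment> \<open>At s = r and s = -r the linear part of \<psi> has size \<mu> * r and exceeds the
    error, so \<psi> lies on opposite sides of its value at 0.\<close>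
  have "\<exists>s\<ge>-r. s \<le> r \<and> \<psi> (p s) = \<psi> 0"
  proof (rule IVT')
    show "\<psi> (p (-r)) \<le> \<psi> 0" 
    proof -
      have "\<bar>\<psi> (p (-r)) - \<psi> 0 + \<mu> * r\<bar> \<le> \<mu> * r / 2" using est(1)[of "-r"] r by simp
      then show ?thesis using \<mu>r by linarith
    qed
    show "\<psi> 0 \<le> \<psi> (p r)" 
    proof -
      have "\<bar>\<psi> (p r) - \<psi> 0 - \<mu> * r\<bar> \<le> \<mu> * r / 2" using est(1)[of r] r by simp
      then show ?thesis using \<mu>r by linarith
    qed
    show "continuous_on {-r..r} (\<lambda>s. \<psi> (p s))"
      by (rule continuous_on_compose2[OF cont]) (auto simp: p_def intro!: continuous_intros)
  qed (use r in auto)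
  then obtain s where "-r \<le> s" "s \<le> r" "\<psi> (p s) = \<psi> 0" by blast
  then have s: "\<bar>s\<bar> \<le> r" "\<psi> (p s) = \<psi> 0" by auto
  have "\<phi> 0 \<le> \<phi> (p s)" by (rule min[OF s(2)])
  moreover have "\<bar>\<nu>\<bar> * r > 0" using \<nu> r by simp
  moreover have "\<nu> * \<tau> = - (\<bar>\<nu>\<bar> * r)" using \<tau>(2) by simp
  ultimately show False using est(2)[OF s(1)] by linarith
qed

text \<open>\<open>A\<close> differs from \<open>M\<close> by a constant and is orthogonal to
  constants, so the integral of A * M is that of the square of \<open>A\<close>. Having mean zero,
  \<open>A\<close> is the derivative of a function that vanishes at both end points.\<close>

lemma mean_free_part:
  fixes M :: "real \<Rightarrow> real"
  assumes ab: "a < b" and M: "continuous_on {a..b} M"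
  defines "A \<equiv> \<lambda>t. M t - integral {a..b} M / (b - a)"
  shows "continuous_on {a..b} A" "integral {a..b} A = 0"
    and "integral {a..b} (\<lambda>t. A t * M t) \<ge> 0"
    and "integral {a..b} (\<lambda>t. A t * M t) = 0 \<Longrightarrow> t \<in> {a..b} \<Longrightarrow> A t = 0"
proof -
  show A: "continuous_on {a..b} A" unfolding A_def by (intro continuous_intros M)
  have Mi: "M integrable_on {a..b}" by (rule integrable_continuous_real[OF M])
  have "integral {a..b} A = integral {a..b} M - integral {a..b} (\<lambda>t. integral {a..b} M / (b - a))"
    unfolding A_def by (rule Henstock_Kurzweil_Integration.integral_diff[OF Mi integrable_const_ivl])
  also have "\<dots> = 0" using ab by simp
  finally show A0: "integral {a..b} A = 0" .
  define c where "c = integral {a..b} M / (b - a)"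
  have AA: "(\<lambda>t. A t * A t) integrable_on {a..b}" and cA: "(\<lambda>t. c * A t) integrable_on {a..b}"
    by (intro integrable_continuous_real continuous_on_mult continuous_on_const A)+
  have "integral {a..b} (\<lambda>t. A t * M t) = integral {a..b} (\<lambda>t. A t * A t + c * A t)"
    by (intro integral_cong) (simp add: A_def c_def[symmetric] algebra_simps)
  also have "\<dots> = integral {a..b} (\<lambda>t. A t * A t)"
    using A0 by (simp add: Henstock_Kurzweil_Integration.integral_add[OF AA cA])
  finally have eq: "integral {a..b} (\<lambda>t. A t * M t) = integral {a..b} (\<lambda>t. A t * A t)" .
  show "integral {a..b} (\<lambda>t. A t * M t) \<ge> 0"
    unfolding eq by (rule Henstock_Kurzweil_Integration.integral_nonneg[OF AA]) simp
  assume "integral {a..b} (\<lambda>t. A t * M t) = 0" "t \<in> {a..b}"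
  then show "A t = 0"
    using integral_eq_0_iff[of a b "\<lambda>t. A t * A t"] ab eq continuous_on_mult[OF A A] by simp
qed

section \<open>Linear dependence on the Lagrangian\<close>

lemma C1_on_diff_scaled:
  assumes "C1_on S f" "C1_on S g"
  shows "C1_on S (\<lambda>p. f p - r * g p)"
proof -
  obtain f' where f': "\<And>p. p \<in> S \<Longrightarrow> (f has_derivative blinfun_apply (f' p)) (at p within S)" "continuous_on S f'"
    using C1_onE[OF assms(1)] by blast
  obtain g' where g': "\<And>p. p \<in> S \<Longrightarrow> (g has_derivative blinfun_apply (g' p)) (at p within S)" "continuous_on S g'"
    using C1_onE[OF assms(2)] by blast
  have "((\<lambda>p. f p - r * g p) has_derivative blinfun_apply (f' p - r *\<^sub>R g' p)) (at p within S)" if "p \<in> S" for p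
    using has_derivative_diff[OF f'(1)[OF that] has_derivative_mult_right[OF g'(1)[OF that], of r]]
    by (simp add: blinfun.diff_left[abs_def] blinfun.scaleR_left[abs_def] blinfun.bilinear_simps)
  moreover have "continuous_on S (\<lambda>p. f' p - r *\<^sub>R g' p)" by (intro continuous_intros f' g')
  ultimately show ?thesis unfolding C1_on_def by (intro exI[of _ "\<lambda>p. f' p - r *\<^sub>R g' p"]) blast
qed

lemma d_z_diff_scaled:
  assumes "C1_on (X \<times> UNIV) L" "C1_on (X \<times> UNIV) G" and p: "p \<in> X \<times> UNIV"
  shows "d_z (\<lambda>p. L p - r * G p) p = d_z L p - r * d_z G p"
proof -
  obtain L' where L': "(L has_derivative blinfun_apply (L' p)) (at p within X \<times> UNIV)"
    using C1_onE[OF assms(1)] p by blast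
  obtain G' where G': "(G has_derivative blinfun_apply (G' p)) (at p within X \<times> UNIV)"
    using C1_onE[OF assms(2)] p by blast
  have "((\<lambda>p. L p - r * G p) has_derivative (\<lambda>x. L' p x - r * G' p x)) (at p within X \<times> UNIV)"
    by (rule has_derivative_diff[OF L' has_derivative_mult_right[OF G', of r]])
  then show ?thesis
    using lagrangian_derivative(4)[OF L' p] lagrangian_derivative(4)[OF G' p] lagrangian_derivative(4)[OF _ p]
    by simp
qed

context fractional_curve
begin

text \<open>The constant is the value at b, namely zero, so the kernel integral of
  \<open>stress\<close> is a multiple of the tail of \<open>force\<close> and hence differentiable.
  This concerns the sum of two kernel integrals; \<open>EL_splits\<close> supplies the derivative of
  one of them, and subtraction that of the other.\<close>

lemma EL_solution_of_constant_momentum: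
  assumes K: "C1_on ({a..b} \<times> UNIV) K" and splits: "EL_splits a b \<alpha> \<beta> l K y"
    and const: "\<And>t. t \<in> {a..b} \<Longrightarrow> momentum K t = c"
  shows "EL_solution a b \<alpha> \<beta> l K y"
proof -
  note Kc = continuous_on_K_partials[OF K] and lc = continuous_on_l_partials and Mc = continuous_on_momentum[OF K]
  define N where "N f t = integral {t..b} (\<lambda>s. (s - t) powr (- \<alpha>) * f s)" for f t
  define f1 where "f1 t = d_v K (jz t)" for t
  define f2 where "f2 t = tail K t * l_v l (jy t)" for t
  have f12: "continuous_on {a..b} f1" "continuous_on {a..b} f2"
    unfolding f1_def f2_def by (intro continuous_intros Kc lc)+
  have g12: "continuous_on {a..b} (\<lambda>t. d_w K (jz t))" "continuous_on {a..b} (\<lambda>t. tail K t * l_w l (jy t))"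
    by (intro continuous_intros Kc lc)+
  have Gam: "Gamma (1 - \<alpha>) > 0" using \<alpha> by (intro Gamma_real_pos) auto
  have "c = 0" using const[of b] ab by (simp add: momentum_def)
  then have N: "N (stress K) t = - Gamma (1 - \<alpha>) * integral {t..b} (force K)" if "t \<in> {a..b}" for t
    using const[OF that] Gam by (simp add: momentum_def N_def field_simps)
  have sub: "continuous_on {t..b} f" if "t \<in> {a..b}" "continuous_on {a..b} f" for t and f :: "real \<Rightarrow> real"
    using that by (auto elim!: continuous_on_subset)
  have Nadd: "N (stress K) t = N f1 t + N f2 t" if "t \<in> {a..b}" for t
    using integral_powr_right_combine[OF _ sub[OF that f12(1)] sub[OF that f12(2)], of "- \<alpha>" 1 1] \<alpha>
    by (simp add: N_def stress_def f1_def f2_def)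
  have main: "rl_deriv_right_exists a b \<alpha> f1 x \<and> rl_deriv_right_exists a b \<alpha> f2 x \<and> EL_lhs a b \<alpha> \<beta> l K y x = 0"
    if x: "x \<in> {a..b}" for x
  proof -
    have cb: "{a..b} = cbox a b" by simp
    have "((\<lambda>t. - Gamma (1 - \<alpha>) * integral {t..b} (force K)) has_real_derivative - Gamma (1 - \<alpha>) * - force K x) (at x within {a..b})"
      by (intro DERIV_cmult integral_has_real_derivative' Mc x)
    then have "((\<lambda>t. - Gamma (1 - \<alpha>) * integral {t..b} (force K)) has_vector_derivative Gamma (1 - \<alpha>) * force K x) (at x within {a..b})"
      by (simp add: has_real_derivative_iff_has_vector_derivative)
    then have dN: "((\<lambda>t. N f1 t + N f2 t) has_vector_derivative Gamma (1 - \<alpha>) * force K x) (at x within {a..b})"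
      by (rule has_vector_derivative_transform[OF x, rotated]) (metis N Nadd)
    have e2: "rl_deriv_right_exists a b \<alpha> f2 x"
      using splits x by (simp add: EL_splits_def f2_def[abs_def])
    then obtain D2 where D2: "(N f2 has_vector_derivative D2) (at x within {a..b})"
      unfolding rl_deriv_right_exists_def N_def[abs_def] using vector_derivative_works by blast
    \<comment> \<open>Existence of the first derivative comes from that of the sum, since
      \<open>d_v K\<close> along the curve is only known to be continuous.\<close>
    have D1: "(N f1 has_vector_derivative Gamma (1 - \<alpha>) * force K x - D2) (at x within {a..b})"
      using has_vector_derivative_diff[OF dN D2] by simp
    then have e1: "rl_deriv_right_exists a b \<alpha> f1 x"
      unfolding rl_deriv_right_exists_def N_def[abs_def]
      by (auto simp: differentiable_def has_vector_derivative_def)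
    have v: "rl_deriv_right a b \<alpha> f1 x + rl_deriv_right a b \<alpha> f2 x = - force K x"
      using vector_derivative_within_cbox[OF ab _ D1[unfolded cb]] vector_derivative_within_cbox[OF ab _ D2[unfolded cb]] x Gam
      unfolding rl_deriv_right_def N_def[abs_def] by (simp add: field_simps)
    have w: "rl_int_right b \<beta> (load K) x = rl_int_right b \<beta> (\<lambda>t. d_w K (jz t)) x +
        rl_int_right b \<beta> (\<lambda>t. tail K t * l_w l (jy t)) x"
      using integral_powr_right_combine[OF _ sub[OF x g12(1)] sub[OF x g12(2)], of "\<beta> - 1" 1 1] \<beta>
      by (simp add: rl_int_right_def load_def add_divide_distrib)
    have "EL_lhs a b \<alpha> \<beta> l K y x = force K x + (rl_deriv_right a b \<alpha> f1 x + rl_deriv_right a b \<alpha> f2 x)"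
      unfolding EL_lhs_def force_def w f1_def[abs_def] f2_def[abs_def] by simp
    then show ?thesis using e1 e2 v by simp
  qed
  then show ?thesis unfolding EL_solution_def f1_def[abs_def] f2_def[abs_def] by blast
qed

lemma EL_splits_diff_scaled:
  assumes L: "C1_on ({a..b} \<times> UNIV) L" and G: "C1_on ({a..b} \<times> UNIV) G"
    and sL: "EL_splits a b \<alpha> \<beta> l L y" and sG: "EL_splits a b \<alpha> \<beta> l G y"
  shows "EL_splits a b \<alpha> \<beta> l (\<lambda>p. L p - r * G p) y"
proof -
  define N where "N K t = integral {t..b} (\<lambda>s. (s - t) powr (- \<alpha>) * (tail K s * l_v l (jy s)))" for K t
  have tail: "tail (\<lambda>p. L p - r * G p) x = tail L x - r * tail G x" if x: "x \<in> {a..b}" for x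
  proof -
    have c: "continuous_on {x..b} (\<lambda>t. d_z L (jz t))" "continuous_on {x..b} (\<lambda>t. d_z G (jz t))"
      using continuous_on_K_partials(4)[OF L] continuous_on_K_partials(4)[OF G] x
      by (auto elim!: continuous_on_subset)
    have "tail (\<lambda>p. L p - r * G p) x = integral {x..b} (\<lambda>t. d_z L (jz t) - r * d_z G (jz t))"
      unfolding tail_dz_def using x d_z_diff_scaled[OF L G jet_z_mem] by (intro integral_cong) auto
    also have "\<dots> = tail L x - r * tail G x"
      unfolding tail_dz_def using c
      by (subst Henstock_Kurzweil_Integration.integral_diff)
        (auto intro!: integrable_continuous_real continuous_intros)
    finally show ?thesis .
  qed
  have tc: "continuous_on {a..b} (\<lambda>s. tail K s * l_v l (jy s))" if "C1_on ({a..b} \<times> UNIV) K" for K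
    by (intro continuous_intros continuous_on_K_partials[OF that] continuous_on_l_partials)
  have N: "N (\<lambda>p. L p - r * G p) t = N L t - r * N G t" if t: "t \<in> {a..b}" for t
  proof -
    have "N (\<lambda>p. L p - r * G p) t =
        integral {t..b} (\<lambda>s. (s - t) powr (- \<alpha>) * (1 * (tail L s * l_v l (jy s)) + - r * (tail G s * l_v l (jy s))))"
      unfolding N_def
    proof (rule integral_cong)
      fix s assume "s \<in> {t..b}"
      then have "s \<in> {a..b}" using t by simp
      then show "(s - t) powr (- \<alpha>) * (tail (\<lambda>p. L p - r * G p) s * l_v l (jy s)) =
          (s - t) powr (- \<alpha>) * (1 * (tail L s * l_v l (jy s)) + - r * (tail G s * l_v l (jy s)))"
        by (simp only: tail) (simp add: algebra_simps)
    qed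
    also have "\<dots> = 1 * N L t + - r * N G t"
      unfolding N_def using \<alpha> t
      by (intro integral_powr_right_combine continuous_on_subset[OF tc[OF L]] continuous_on_subset[OF tc[OF G]]) auto
    finally show ?thesis by simp
  qed
  have "N (\<lambda>p. L p - r * G p) differentiable (at x within {a..b})" if x: "x \<in> {a..b}" for x
  proof -
    have d: "N L differentiable (at x within {a..b})" "N G differentiable (at x within {a..b})"
      using sL sG x by (auto simp: EL_splits_def rl_deriv_right_exists_def N_def[abs_def])
    have "(\<lambda>t. N L t - r * N G t) differentiable (at x within {a..b})"
      using d by (intro differentiable_diff differentiable_mult differentiable_const)
    then show ?thesis
      by (rule differentiable_transform_within[OF _ zero_less_one x]) (simp add: N)
  qed
  then show ?thesis by (simp add: EL_splits_def rl_deriv_right_exists_def N_def[abs_def])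
qed

text \<open>By linearity of the fractional operators the perturbed jets are affine in c, so the
  abstract two-parameter result applies. Its derivative is \<open>first_variation\<close> for the
  combined direction.\<close>

lemma functional_derivative:
  assumes K: "C1_on ({a..b} \<times> UNIV) K"
    and h: "primitive_on a b g h" and k: "primitive_on a b m k" and 0: "h a = 0" "k a = 0"
  defines "\<Phi> \<equiv> \<lambda>c. functional a b \<alpha> \<beta> l K (\<lambda>t. y t + (fst c * h t + snd c * k t))"
  shows "continuous_on UNIV \<Phi>"
    and "(\<Phi> has_derivative (\<lambda>c. integral {a..b} (\<lambda>t. g t * momentum K t) * fst c +
            integral {a..b} (\<lambda>t. m t * momentum K t) * snd c)) (at 0)"
proof -
  obtain l' where l': "\<And>p. p \<in> {a..b} \<times> UNIV \<Longrightarrow> (l has_derivative blinfun_apply (l' p)) (at p within {a..b} \<times> UNIV)"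
    "continuous_on ({a..b} \<times> UNIV) l'" using C1_onE[OF l] by blast
  obtain K' where K': "\<And>p. p \<in> {a..b} \<times> UNIV \<Longrightarrow> (K has_derivative blinfun_apply (K' p)) (at p within {a..b} \<times> UNIV)"
    "continuous_on ({a..b} \<times> UNIV) K'" using C1_onE[OF K] by blast
  let ?v = "variation a \<alpha> \<beta> g h" and ?w = "variation a \<alpha> \<beta> m k"
  note comb = primitive_on_combine[OF h k]
  have jet: "jet a \<alpha> \<beta> (\<lambda>t. y t + (fst c * h t + snd c * k t)) x = jy x + (fst c *\<^sub>R ?v x + snd c *\<^sub>R ?w x)"
    if "x \<in> {a..b}" for c :: "real \<times> real" and x
    by (simp add: jet_add_primitive[OF comb that] variation_combine[OF h k that])
  have \<Phi>: "\<Phi> = (\<lambda>c. integral {a..b} (\<lambda>x. K (with_z (jy x + (fst c *\<^sub>R ?v x + snd c *\<^sub>R ?w x))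
        (integral {a..x} (\<lambda>t. l (jy t + (fst c *\<^sub>R ?v t + snd c *\<^sub>R ?w t)))))))"
    unfolding \<Phi>_def functional_def jet_z_eq
  proof (intro ext integral_cong)
    fix c :: "real \<times> real" and x assume x: "x \<in> {a..b}"
    have "integral {a..x} (\<lambda>t. l (jet a \<alpha> \<beta> (\<lambda>t. y t + (fst c * h t + snd c * k t)) t)) =
        integral {a..x} (\<lambda>t. l (jy t + (fst c *\<^sub>R ?v t + snd c *\<^sub>R ?w t)))"
      by (rule integral_cong) (use x jet in auto)
    then show "K (with_z (jet a \<alpha> \<beta> (\<lambda>t. y t + (fst c * h t + snd c * k t)) x)
            (integral {a..x} (\<lambda>t. l (jet a \<alpha> \<beta> (\<lambda>t. y t + (fst c * h t + snd c * k t)) t)))) =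
        K (with_z (jy x + (fst c *\<^sub>R ?v x + snd c *\<^sub>R ?w x))
        (integral {a..x} (\<lambda>t. l (jy t + (fst c *\<^sub>R ?v t + snd c *\<^sub>R ?w t)))))"
      by (simp add: jet[OF x])
  qed
  have hyps: "a \<le> b" "continuous_on {a..b} jy" "continuous_on {a..b} ?v" "continuous_on {a..b} ?w"
    "\<And>x. x \<in> {a..b} \<Longrightarrow> fst (jy x) \<in> {a..b}" "\<And>x. fst (?v x) = 0" "\<And>x. fst (?w x) = 0"
    using ab continuous_on_jet continuous_on_variation[OF h] continuous_on_variation[OF k]
    by (auto simp: variation_def jet_def)
  show "continuous_on UNIV \<Phi>"
    unfolding \<Phi> by (rule two_param_functional_derivative(1)[OF hyps l' K'])
  have D: "integral {a..b} (\<lambda>x. K' (with_z (jy x) (integral {a..x} (\<lambda>t. l (jy t))))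
        (with_z (fst c *\<^sub>R ?v x + snd c *\<^sub>R ?w x)
          (integral {a..x} (\<lambda>t. l' (jy t) (fst c *\<^sub>R ?v t + snd c *\<^sub>R ?w t))))) =
      integral {a..b} (\<lambda>t. g t * momentum K t) * fst c + integral {a..b} (\<lambda>t. m t * momentum K t) * snd c"
    for c :: "real \<times> real"
  proof -
    let ?u = "variation a \<alpha> \<beta> (\<lambda>t. fst c * g t + snd c * m t) (\<lambda>t. fst c * h t + snd c * k t)"
    have u: "fst c *\<^sub>R ?v x + snd c *\<^sub>R ?w x = ?u x" if "x \<in> {a..b}" for x
      using variation_combine[OF h k that] by simp
    have "integral {a..x} (\<lambda>t. l' (jy t) (fst c *\<^sub>R ?v t + snd c *\<^sub>R ?w t)) = integral {a..x} (\<lambda>t. l' (jy t) (?u t))"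
      if "x \<in> {a..b}" for x
      by (rule integral_cong) (use that u in auto)
    then have "integral {a..b} (\<lambda>x. K' (with_z (jy x) (integral {a..x} (\<lambda>t. l (jy t))))
        (with_z (fst c *\<^sub>R ?v x + snd c *\<^sub>R ?w x)
          (integral {a..x} (\<lambda>t. l' (jy t) (fst c *\<^sub>R ?v t + snd c *\<^sub>R ?w t))))) =
      integral {a..b} (\<lambda>x. K' (jz x) (with_z (?u x) (integral {a..x} (\<lambda>t. l' (jy t) (?u t)))))"
      by (intro integral_cong) (simp add: u jet_z_eq)
    also have "\<dots> = integral {a..b} (\<lambda>t. (fst c * g t + snd c * m t) * momentum K t)"
      by (rule first_variation[OF K comb _ l'(1) K'(1)]) (simp_all add: 0)
    also have "\<dots> = integral {a..b} (\<lambda>t. fst c * (g t * momentum K t) + snd c * (m t * momentum K t))"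
      by (simp add: algebra_simps)
    also have "\<dots> = integral {a..b} (\<lambda>t. g t * momentum K t) * fst c + integral {a..b} (\<lambda>t. m t * momentum K t) * snd c"
      using h k continuous_on_momentum(4)[OF K]
      by (subst Henstock_Kurzweil_Integration.integral_add)
        (auto intro!: integrable_continuous_real continuous_intros simp: primitive_on_def)
    finally show ?thesis .
  qed
  show "(\<Phi> has_derivative (\<lambda>c. integral {a..b} (\<lambda>t. g t * momentum K t) * fst c +
            integral {a..b} (\<lambda>t. m t * momentum K t) * snd c)) (at 0)"
    using two_param_functional_derivative(2)[OF hyps l' K'] unfolding \<Phi> D .
qed

lemma functional_diff_scaled:
  assumes L: "C1_on ({a..b} \<times> UNIV) L" and G: "C1_on ({a..b} \<times> UNIV) G"
  shows "functional a b \<alpha> \<beta> l (\<lambda>p. L p - r * G p) y = functional a b \<alpha> \<beta> l L y - r * functional a b \<alpha> \<beta> l G y"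
proof -
  have "continuous_on {a..b} (\<lambda>x. L (jz x))" "continuous_on {a..b} (\<lambda>x. G (jz x))"
    by (intro continuous_on_along_jet_z C1_on_imp_continuous_on L G)+
  then show ?thesis
    unfolding functional_def
    by (subst Henstock_Kurzweil_Integration.integral_diff) (auto intro!: integrable_continuous_real continuous_intros)
qed

text \<open>The integral is that of the squared deviation of the momentum from its mean. In
  contrapositive form this gives a direction that changes the constraint; used directly it yields
  the final equation.\<close>

lemma EL_solution_of_mean_free_momentum:
  assumes K: "C1_on ({a..b} \<times> UNIV) K" and splits: "EL_splits a b \<alpha> \<beta> l K y"
    and 0: "integral {a..b} (\<lambda>t. (momentum K t - integral {a..b} (momentum K) / (b - a)) * momentum K t) = 0"
  shows "EL_solution a b \<alpha> \<beta> l K y"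
  using mean_free_part(4)[OF ab continuous_on_momentum(4)[OF K] 0]
  by (intro EL_solution_of_constant_momentum[OF K splits]) auto

end

section \<open>The multiplier rule for the isoperimetric problem\<close>

theorem theorem14:
  fixes a b \<alpha> \<beta> y\<^sub>a y\<^sub>b \<gamma> :: real
    and L G :: lagrangian and l :: integrand
    and y :: "real \<Rightarrow> real"
  assumes "a < b" and "0 < \<alpha>" and "\<alpha> < 1" and "0 < \<beta>"
    and "C1_on ({a..b} \<times> UNIV) L" and "C1_on ({a..b} \<times> UNIV) G" and "C1_on ({a..b} \<times> UNIV) l"
    and "y \<in> admissible_class a b \<alpha> \<beta>"
    and "y a = y\<^sub>a" and "y b = y\<^sub>b" and "functional a b \<alpha> \<beta> l G y = \<gamma>"
    and "\<And>u. u \<in> admissible_class a b \<alpha> \<beta> \<Longrightarrow> u a = y\<^sub>a \<Longrightarrow> u b = y\<^sub>b \<Longrightarrow>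
            functional a b \<alpha> \<beta> l G u = \<gamma> \<Longrightarrow>
            functional a b \<alpha> \<beta> l L y \<le> functional a b \<alpha> \<beta> l L u"
    and "EL_splits a b \<alpha> \<beta> l L y" and "EL_splits a b \<alpha> \<beta> l G y"
    and "\<not> EL_solution a b \<alpha> \<beta> l G y"
  shows "\<exists>lam :: real. EL_solution a b \<alpha> \<beta> l (\<lambda>p. L p - lam * G p) y"
proof -
  note L = assms(5) and G = assms(6)
  interpret fractional_curve a b \<alpha> \<beta> l y by unfold_locales (use assms in auto)
  note A = mean_free_part[OF ab continuous_on_momentum(4)[OF G]]
  define g where "g t = momentum G t - integral {a..b} (momentum G) / (b - a)" for t
  have g: "continuous_on {a..b} g" "integral {a..b} g = 0"
    using A(1,2) by (simp_all add: g_def[abs_def])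
  define \<mu> where "\<mu> = integral {a..b} (\<lambda>t. g t * momentum G t)"
  have "\<mu> \<noteq> 0"
    using EL_solution_of_mean_free_momentum[OF G assms(14)] assms(15) by (auto simp: \<mu>_def g_def)
  then have \<mu>: "\<mu> > 0" using A(3) by (simp add: \<mu>_def g_def)
  \<comment> \<open>Solves the linear equation saying that the integral of g *
    \<open>momentum F\<close> is zero, where \<open>F\<close> is L - lam * G.\<close>
  define lam where "lam = integral {a..b} (\<lambda>t. g t * momentum L t) / \<mu>"
  define F where "F = (\<lambda>p. L p - lam * G p)"
  have F: "C1_on ({a..b} \<times> UNIV) F" unfolding F_def by (rule C1_on_diff_scaled[OF L G])
  have sF: "EL_splits a b \<alpha> \<beta> l F y"
    unfolding F_def by (rule EL_splits_diff_scaled[OF L G assms(13,14)])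
  define m where "m t = momentum F t - integral {a..b} (momentum F) / (b - a)" for t
  have m: "continuous_on {a..b} m" "integral {a..b} m = 0"
    using mean_free_part(1,2)[OF ab continuous_on_momentum(4)[OF F]] by (simp_all add: m_def[abs_def])
  obtain h where h: "primitive_on a b g h" "h a = 0" "h b = 0"
    using primitive_exists[OF less_imp_le[OF ab] g(1)] g(2) by metis
  obtain k where k: "primitive_on a b m k" "k a = 0" "k b = 0"
    using primitive_exists[OF less_imp_le[OF ab] m(1)] m(2) by metis
  define u where "u c t = y t + (fst c * h t + snd c * k t)" for c :: "real \<times> real" and t
  have u: "u c \<in> admissible_class a b \<alpha> \<beta>" for c
    unfolding u_def[abs_def]
    by (rule admissible_add_primitive[OF \<alpha> \<beta> y primitive_on_combine[OF h(1) k(1)]])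
  have u0: "u 0 = y" by (simp add: u_def[abs_def])
  define J where "J K c = functional a b \<alpha> \<beta> l K (u c)" for K c
  have D: "continuous_on UNIV (J K)"
    "(J K has_derivative (\<lambda>c. integral {a..b} (\<lambda>t. g t * momentum K t) * fst c +
       integral {a..b} (\<lambda>t. m t * momentum K t) * snd c)) (at 0)" if "C1_on ({a..b} \<times> UNIV) K" for K
    using functional_derivative[OF that h(1) k(1) h(2) k(2)] unfolding J_def[abs_def] u_def[abs_def] .
  have JF: "J F c = J L c - lam * J G c" for c
  proof -
    \<comment> \<open>The perturbed curves are admissible themselves, so integrability, and with it
      linearity of the functional in K, holds along each of them.\<close>
    interpret c: fractional_curve a b \<alpha> \<beta> l "u c" by unfold_locales (use u assms in auto)
    show ?thesis unfolding J_def F_def by (rule c.functional_diff_scaled[OF L G])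
  qed
  define \<nu> where "\<nu> = integral {a..b} (\<lambda>t. m t * momentum F t)"
  have dF: "(J F has_derivative (\<lambda>c. integral {a..b} (\<lambda>t. g t * momentum F t) * fst c + \<nu> * snd c)) (at 0)"
    unfolding \<nu>_def by (rule D(2)[OF F])
  have "((\<lambda>c. J L c - lam * J G c) has_derivative (\<lambda>c.
      (integral {a..b} (\<lambda>t. g t * momentum L t) * fst c + integral {a..b} (\<lambda>t. m t * momentum L t) * snd c) -
      lam * (\<mu> * fst c + integral {a..b} (\<lambda>t. m t * momentum G t) * snd c))) (at 0)"
    unfolding \<mu>_def by (intro has_derivative_diff has_derivative_mult_right D(2) L G)
  \<comment> \<open>Linearity of the momentum in K, tested against g, is read off from the
    uniqueness of the derivative of \<open>J F\<close>; (1, 0) selects the first direction.\<close>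
  from fun_cong[OF has_derivative_unique[OF dF this[folded JF]], of "(1, 0)"]
  have "integral {a..b} (\<lambda>t. g t * momentum F t) = integral {a..b} (\<lambda>t. g t * momentum L t) - lam * \<mu>"
    by simp
  also have "\<dots> = 0" using \<mu> by (simp add: lam_def)
  finally have dF': "(J F has_derivative (\<lambda>c. \<nu> * snd c)) (at 0)" using dF by simp
  have dG: "(J G has_derivative (\<lambda>c. \<mu> * fst c + integral {a..b} (\<lambda>t. m t * momentum G t) * snd c)) (at 0)"
    unfolding \<mu>_def by (rule D(2)[OF G])
  have "\<nu> = 0"
  \<comment> \<open>On the level set of \<open>J G\<close> the perturbed curves are competitors,
    since \<open>h\<close> and \<open>k\<close> vanish at both ends, and there \<open>J F\<close>
    and \<open>J L\<close> differ by a constant. Minimality for L thus carries over to F.\<close>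
  proof (rule two_param_multiplier[OF D(1)[OF G] dG \<mu> dF'])
    fix c assume c: "J G c = J G 0"
    then have "J L 0 \<le> J L c"
      unfolding J_def u0
      by (intro assms(12) u) (use assms(9-11) h k in \<open>auto simp: u_def u0\<close>)
    then show "J F 0 \<le> J F c" by (simp add: JF c)
  qed
  then have "EL_solution a b \<alpha> \<beta> l F y"
    by (intro EL_solution_of_mean_free_momentum[OF F sF]) (simp add: \<nu>_def m_def)
  then show ?thesis unfolding F_def by blast
qed

end
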